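(* Let $\delta_1,\delta_2,\delta_3\in[0,1]$ be independent of $\varepsilon$, and consider the BBMH system with relaxation parameter $\varepsilon>0$ in the split form $q_t=f(q)+g(q)$, $q=(u,v,w)^T$, with $$f(q)=-\begin{pmatrix}uu_x+\delta_1\varepsilon v_x\\ \frac{\delta_2}{\varepsilon}u_x\\ \delta_3\varepsilon^2w_x\end{pmatrix},\qquad g(q)=-\begin{pmatrix}(1-\delta_1\varepsilon)v_x\\ \frac{1-\delta_2\varepsilon}{\varepsilon^2}u_x-\frac1{\varepsilon^2}w\\ (1-\delta_3)\varepsilon^2w_x+v\end{pmatrix},$$ initialized with well-prepared initial data, i.e. $u(x,0)=\eta(x,0)$ and $w(x,0)=\eta_x(x,0)$, and with $v(x,0)=v_0(x;\varepsilon)$, where $v_0(x;\varepsilon)$ is a sufficiently smooth function which may depend on $\varepsilon$ in an arbitrary way. Then every globally stiffly accurate (GSA) IMEX Runge-Kutta method of type I (discrete in time with time step $\Delta t$, continuous in space) is asymptotic preserving, i.e., for the numerical solution $(u^n,v^n,w^n)$ after $n\ge1$ steps, $$u^n\to\eta^n,\qquad v^n\to-D_t\eta^n_x,\qquad w^n\to\eta^n_x\qquad\text{for }\varepsilon\to0,$$ where $\eta^n$ is the numerical solution of the BBM equation $\eta_t+\eta\eta_x-\eta_{txx}=0$ obtained with the explicit part of the IMEX method, and $D_t$ is the discrete time derivative $$D_t\eta_x^{n+1}:=\sum_{j=1}^s\alpha_{sj}\,\frac{\eta_x^{(j)}-\eta_x^n}{\Delta t},\qquad A^{-1}=(\alpha_{ij}),$$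 with $\eta^{(j)}$ the stages of the BBM scheme in the step from $t^n$ to $t^{n+1}$.
   Context: Periodic boundary conditions in $x$ are used. The BBMH system is $u_t+uu_x+v_x=0$, $v_t+\varepsilon^{-2}u_x=\varepsilon^{-2}w$, $w_t+\varepsilon^2w_x=-v$, a hyperbolic approximation of the BBM equation, whose solution is denoted $\eta$. IMEX method: an $s$-stage diagonally implicit IMEX Runge-Kutta method is given by a strictly lower triangular matrix $\tilde A=(\tilde a_{ij})$ and weights $\tilde b$ (explicit part), and a lower triangular matrix $A=(a_{ij})$ and weights $b$ (implicit part). Applied to $q_t=f(q)+g(q)$ it reads $$q^{(i)}=q^n+\Delta t\sum_{j=1}^{i-1}\tilde a_{ij}f(q^{(j)})+\Delta t\sum_{j=1}^{i}a_{ij}g(q^{(j)}),\qquad q^{n+1}=q^n+\Delta t\sum_{i=1}^s\tilde b_if(q^{(i)})+\Delta t\sum_{i=1}^sb_ig(q^{(i)}).$$ It is of type I if $A$ is invertible. It is globally stiffly accurate (GSA) if $\tilde a_{si}=\tilde b_i$ and $a_{si}=b_i$ for all $i\in\{1,\dots,s\}$. BBM scheme: applying the explicit part to $(\mathrm I-\partial_x^2)\eta_t=-\eta\eta_x$ gives, with $\eta^0=\eta(\cdot,0)$, $$(\mathrm I-\partial_x^2)\frac{\eta^{(i)}-\eta^n}{\Delta t}=-\sum_{j=1}^{i-1}\tilde a_{ij}\,\eta^{(j)}\eta^{(j)}_x,\qquad(\mathrm I-\partial_x^2)\frac{\eta^{n+1}-\eta^n}{\Delta t}=-\sum_{i=1}^s\tilde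 b_i\,\eta^{(i)}\eta^{(i)}_x .$$
   Formalization: The initial v_0 may not depend on ε quite arbitrarily: ε² times v_0 and its x-derivatives up to a finite order must tend to 0 uniformly; otherwise the claim fails (η=0, v_0=ε^{-2}, implicit Euler gives v^1→1/Δt²). *)

theory Defs
  imports "HOL-Analysis.Analysis" "Jordan_Normal_Form.Gauss_Jordan_Elimination"
begin

no_notation Finite_Cartesian_Product.vec_nth (infixl \<open>$\<close> 90)

section \<open>IMEX Runge-Kutta methods\<close>

text \<open>
  Matrix and vector indices start at 0, so the stages are numbered 0, ..., s - 1 and the last
  stage has index s - 1.
\<close>

record imex =
  stages :: nat
  expl_mat :: "real mat"
  expl_wts :: "real vec"
  impl_mat :: "real mat"
  impl_wts :: "real vec"

definition dirk_imex :: "imex \<Rightarrow> bool" where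
  "dirk_imex M \<longleftrightarrow>
     0 < stages M \<and>
     expl_mat M \<in> carrier_mat (stages M) (stages M) \<and>
     expl_wts M \<in> carrier_vec (stages M) \<and>
     impl_mat M \<in> carrier_mat (stages M) (stages M) \<and>
     impl_wts M \<in> carrier_vec (stages M) \<and>
     (\<forall>i<stages M. \<forall>j<stages M. i \<le> j \<longrightarrow> expl_mat M $$ (i, j) = 0) \<and>
     (\<forall>i<stages M. \<forall>j<stages M. i < j \<longrightarrow> impl_mat M $$ (i, j) = 0)"

definition type_I :: "imex \<Rightarrow> bool" where
  "type_I M \<longleftrightarrow> invertible_mat (impl_mat M)"

definition GSA :: "imex \<Rightarrow> bool" where
  "GSA M \<longleftrightarrow>
     (\<forall>i<stages M. expl_mat M $$ (stages M - 1, i) = expl_wts M $ i \<and>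
                   impl_mat M $$ (stages M - 1, i) = impl_wts M $ i)"

text \<open>
  One step from \<open>q\<close> to \<open>q'\<close> with stages \<open>Q\<close>, for an evolution equation whose right-hand side
  \<open>f + g\<close> consists of operators on functions of the space variable.
\<close>

definition imex_step ::
  "imex \<Rightarrow> real \<Rightarrow> ((real \<Rightarrow> 'b) \<Rightarrow> real \<Rightarrow> 'b) \<Rightarrow> ((real \<Rightarrow> 'b) \<Rightarrow> real \<Rightarrow> 'b) \<Rightarrow>
   (real \<Rightarrow> 'b::real_vector) \<Rightarrow> (nat \<Rightarrow> real \<Rightarrow> 'b) \<Rightarrow> (real \<Rightarrow> 'b) \<Rightarrow> bool" where
  "imex_step M \<tau> f g q Q q' \<longleftrightarrow>
     (\<forall>i<stages M. \<forall>x.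
        Q i x = q x + \<tau> *\<^sub>R (\<Sum>j<i. (expl_mat M $$ (i, j)) *\<^sub>R f (Q j) x)
                    + \<tau> *\<^sub>R (\<Sum>j\<le>i. (impl_mat M $$ (i, j)) *\<^sub>R g (Q j) x)) \<and>
     (\<forall>x.
        q' x = q x + \<tau> *\<^sub>R (\<Sum>i<stages M. (expl_wts M $ i) *\<^sub>R f (Q i) x)
                   + \<tau> *\<^sub>R (\<Sum>i<stages M. (impl_wts M $ i) *\<^sub>R g (Q i) x))"

definition impl_inv :: "imex \<Rightarrow> real mat" where
  "impl_inv M = the (mat_inverse (impl_mat M))"

text \<open>
  The discrete time derivative at the end of a step which starts from the value \<open>p\<close> and has the
  stage values \<open>P j\<close>.
\<close>

definition discrete_dt ::
  "imex \<Rightarrow> real \<Rightarrow> (real \<Rightarrow> real) \<Rightarrow> (nat \<Rightarrow> real \<Rightarrow> real) \<Rightarrow> real \<Rightarrow> real" where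
  "discrete_dt M \<tau> p P x =
     (\<Sum>j<stages M. impl_inv M $$ (stages M - 1, j) * ((P j x - p x) / \<tau>))"


section \<open>Periodic functions of finite smoothness\<close>

definition periodic_C :: "nat \<Rightarrow> real \<Rightarrow> (real \<Rightarrow> real) \<Rightarrow> bool" where
  "periodic_C k L \<phi> \<longleftrightarrow>
     (\<forall>x. \<phi> (x + L) = \<phi> x) \<and>
     (\<forall>j<k. (deriv ^^ j) \<phi> differentiable_on UNIV) \<and>
     continuous_on UNIV ((deriv ^^ k) \<phi>)"


section \<open>The BBMH system\<close>

abbreviation u_of :: "(real \<Rightarrow> real \<times> real \<times> real) \<Rightarrow> real \<Rightarrow> real" where
  "u_of q \<equiv> \<lambda>x. fst (q x)"

abbreviation v_of :: "(real \<Rightarrow> real \<times> real \<times> real) \<Rightarrow> real \<Rightarrow> real" where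
  "v_of q \<equiv> \<lambda>x. fst (snd (q x))"

abbreviation w_of :: "(real \<Rightarrow> real \<times> real \<times> real) \<Rightarrow> real \<Rightarrow> real" where
  "w_of q \<equiv> \<lambda>x. snd (snd (q x))"

definition bbmh_f ::
  "real \<Rightarrow> real \<Rightarrow> real \<Rightarrow> real \<Rightarrow> (real \<Rightarrow> real \<times> real \<times> real) \<Rightarrow> real \<Rightarrow> real \<times> real \<times> real" where
  "bbmh_f \<delta>1 \<delta>2 \<delta>3 \<epsilon> q x =
     - (u_of q x * deriv (u_of q) x + \<delta>1 * \<epsilon> * deriv (v_of q) x,
        \<delta>2 / \<epsilon> * deriv (u_of q) x,
        \<delta>3 * \<epsilon>\<^sup>2 * deriv (w_of q) x)"

definition bbmh_g ::
  "real \<Rightarrow> real \<Rightarrow> real \<Rightarrow> real \<Rightarrow> (real \<Rightarrow> real \<times> real \<times> real) \<Rightarrow> real \<Rightarrow> real \<times> real \<times> real" where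
  "bbmh_g \<delta>1 \<delta>2 \<delta>3 \<epsilon> q x =
     - ((1 - \<delta>1 * \<epsilon>) * deriv (v_of q) x,
        (1 - \<delta>2 * \<epsilon>) / \<epsilon>\<^sup>2 * deriv (u_of q) x - 1 / \<epsilon>\<^sup>2 * w_of q x,
        (1 - \<delta>3) * \<epsilon>\<^sup>2 * deriv (w_of q) x + v_of q x)"

lemma bbmh_split:
  assumes "\<epsilon> \<noteq> 0"
  shows "bbmh_f \<delta>1 \<delta>2 \<delta>3 \<epsilon> q x + bbmh_g \<delta>1 \<delta>2 \<delta>3 \<epsilon> q x =
     (- (u_of q x * deriv (u_of q) x) - deriv (v_of q) x,
      - (1 / \<epsilon>\<^sup>2 * deriv (u_of q) x) + 1 / \<epsilon>\<^sup>2 * w_of q x,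
      - (\<epsilon>\<^sup>2 * deriv (w_of q) x) - v_of q x)"
  using assms by (simp add: bbmh_f_def bbmh_g_def field_simps power2_eq_square)

definition bbmh_state :: "real \<Rightarrow> (real \<Rightarrow> real \<times> real \<times> real) \<Rightarrow> bool" where
  "bbmh_state L q \<longleftrightarrow>
     periodic_C 1 L (u_of q) \<and> periodic_C 1 L (v_of q) \<and> periodic_C 1 L (w_of q)"

text \<open>
  The first \<open>n\<close> steps: \<open>q k\<close> is the numerical solution after \<open>k\<close> steps, \<open>Q k i\<close> is stage \<open>i\<close> of
  the step from \<open>q k\<close> to \<open>q (Suc k)\<close>.
\<close>

definition bbmh_numerical_solution ::
  "imex \<Rightarrow> real \<Rightarrow> real \<Rightarrow> real \<Rightarrow> real \<Rightarrow> real \<Rightarrow> real \<Rightarrow> nat \<Rightarrow> (real \<Rightarrow> real \<times> real \<times> real) \<Rightarrow>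
   (nat \<Rightarrow> real \<Rightarrow> real \<times> real \<times> real) \<Rightarrow> (nat \<Rightarrow> nat \<Rightarrow> real \<Rightarrow> real \<times> real \<times> real) \<Rightarrow> bool" where
  "bbmh_numerical_solution M \<delta>1 \<delta>2 \<delta>3 \<epsilon> L \<tau> n q0 q Q \<longleftrightarrow>
     q 0 = q0 \<and>
     (\<forall>k\<le>n. bbmh_state L (q k)) \<and>
     (\<forall>k<n. \<forall>i<stages M. bbmh_state L (Q k i)) \<and>
     (\<forall>k<n. imex_step M \<tau> (bbmh_f \<delta>1 \<delta>2 \<delta>3 \<epsilon>) (bbmh_g \<delta>1 \<delta>2 \<delta>3 \<epsilon>) (q k) (Q k) (q (Suc k)))"


section \<open>The explicit scheme for the BBM equation\<close>

definition helmholtz :: "(real \<Rightarrow> real) \<Rightarrow> real \<Rightarrow> real" where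
  "helmholtz \<phi> x = \<phi> x - deriv (deriv \<phi>) x"

definition bbm_step ::
  "imex \<Rightarrow> real \<Rightarrow> (real \<Rightarrow> real) \<Rightarrow> (nat \<Rightarrow> real \<Rightarrow> real) \<Rightarrow> (real \<Rightarrow> real) \<Rightarrow> bool" where
  "bbm_step M \<tau> \<eta> H \<eta>' \<longleftrightarrow>
     (\<forall>i<stages M. \<forall>x.
        helmholtz (\<lambda>y. (H i y - \<eta> y) / \<tau>) x =
          - (\<Sum>j<i. expl_mat M $$ (i, j) * (H j x * deriv (H j) x))) \<and>
     (\<forall>x.
        helmholtz (\<lambda>y. (\<eta>' y - \<eta> y) / \<tau>) x =
          - (\<Sum>i<stages M. expl_wts M $ i * (H i x * deriv (H i) x)))"

definition bbm_numerical_solution ::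
  "imex \<Rightarrow> real \<Rightarrow> real \<Rightarrow> nat \<Rightarrow> (real \<Rightarrow> real) \<Rightarrow>
   (nat \<Rightarrow> real \<Rightarrow> real) \<Rightarrow> (nat \<Rightarrow> nat \<Rightarrow> real \<Rightarrow> real) \<Rightarrow> bool" where
  "bbm_numerical_solution M L \<tau> n \<eta>0 \<eta> H \<longleftrightarrow>
     \<eta> 0 = \<eta>0 \<and>
     (\<forall>k\<le>n. periodic_C 2 L (\<eta> k)) \<and>
     (\<forall>k<n. \<forall>i<stages M. periodic_C 2 L (H k i)) \<and>
     (\<forall>k<n. bbm_step M \<tau> (\<eta> k) (H k) (\<eta> (Suc k)))"


section \<open>Initial data\<close>

text \<open>
  No expansion of \<open>v0\<close> in powers of \<open>\<epsilon>\<close> is assumed and no limit of \<open>v0\<close> is prescribed; \<open>v0\<close> need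
  not even stay bounded. Some growth restriction is needed, though: for
  \<open>\<eta>\<^sub>0 = 0\<close> and \<open>v\<^sub>0 = \<epsilon>\<^sup>-\<^sup>2\<close> the implicit Euler stage gives
  \<open>v = 1 / (\<epsilon>\<^sup>2 + \<tau>\<^sup>2)\<close>, which does not tend to 0.
\<close>

definition admissible_v0 :: "nat \<Rightarrow> real \<Rightarrow> (real \<Rightarrow> real \<Rightarrow> real) \<Rightarrow> bool" where
  "admissible_v0 N L v0 \<longleftrightarrow>
     (\<forall>\<epsilon>>0. periodic_C N L (v0 \<epsilon>)) \<and>
     (\<forall>k\<le>N. uniform_limit UNIV (\<lambda>\<epsilon> x. \<epsilon>\<^sup>2 * (deriv ^^ k) (v0 \<epsilon>) x) (\<lambda>x. 0) (at_right 0))"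

end

theory Submission
  imports Defs "Jordan_Normal_Form.Determinant"
begin

text \<open>
  The limit scheme is \<open>U = H\<close>, \<open>W = H\<^sub>x\<close> together with the stage values \<open>V\<close> determined by
  \<open>W - W\<^sup>n = - \<tau> A V\<close>. The difference to the BBMH stages solves, for each stage, a linear
  constant-coefficient system whose data tend to 0 in \<open>C\<^sup>k\<close>, and this system is stable uniformly in
  \<open>\<epsilon>\<close>: eliminating \<open>u\<close> and most of \<open>w\<close> leaves an equation
  \<open>(\<epsilon>\<^sup>2 + c\<^sup>2) v - c\<^sup>2 \<alpha> \<beta> v\<^sub>x\<^sub>x = S\<close> for \<open>v\<close>, where \<open>c = \<tau> a\<^sub>i\<^sub>i \<noteq> 0\<close>
  and the remaining \<open>w\<^sub>x\<close> in \<open>S\<close> carries a factor \<open>\<epsilon>\<^sup>2\<close>, so that the maximum principle applies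
  whatever the sign of \<open>c\<close>. Each stage costs three derivatives, which the smoothness
  of the initial data pays for. By the GSA property the last stage is the new time level.
\<close>

section \<open>Periodic functions with bounded derivatives\<close>

text \<open>Smoothness and size of a stage are controlled separately. Smoothness is bootstrapped
  from C^1 by solving the equations for the highest derivatives; this divides by
  \<open>\<epsilon>\<^sup>2\<close> and yields no uniform bound. Uniform bounds come from sup
  estimates at extrema, carried to higher derivatives by differentiating the system. Of the three
  derivatives per stage, one is lost because the data of a stage contain derivatives of earlier
  stages, and two because a C^m bound on the unknowns is drawn from C^(m+2) bounds on the data. Over
  \<open>n\<close> steps this makes \<open>3 * stages M * n\<close>. The additional 4 lets the limit
  values be inserted into the equations for positive \<open>\<epsilon>\<close>: the residual must be
  small in C^(m+2) and contains the derivative of \<open>V\<close>, which in turn contains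
  \<open>H\<^sub>x\<close>. The old value of \<open>v\<close> enters a stage only as
  \<open>\<epsilon>\<^sup>2 * v\<close>, because its equation is multiplied by
  \<open>\<epsilon>\<^sup>2\<close>. The quantity propagated from step to step is therefore the
  limit 0 of \<open>\<epsilon>\<^sup>2 * v\<close>, which the initial data supply and which each
  step restores, since the new \<open>v\<close> converges.\<close>

lemma funpow_deriv_Suc: "(deriv ^^ Suc k) \<phi> = (deriv ^^ k) (deriv \<phi>)"
  by (simp only: funpow_Suc_right o_apply)

text \<open>\<open>deriv\<close> is a choice over the possible derivative values, and these are the
  same at both points; hence differentiability is not at issue.\<close>

lemma deriv_periodic:
  fixes \<phi> :: "real \<Rightarrow> real"
  assumes "\<And>x. \<phi> (x + L) = \<phi> x"
  shows "deriv \<phi> (x + L) = deriv \<phi> x"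
proof -
  have "(\<phi> has_field_derivative D) (at (x + L)) \<longleftrightarrow> (\<phi> has_field_derivative D) (at x)" for D
    using DERIV_shift[of \<phi> D x L] assms by (simp add: fun_eq_iff)
  then show ?thesis
    by (simp add: deriv_def)
qed

lemma periodic_C_0: "periodic_C 0 L \<phi> \<longleftrightarrow> (\<forall>x. \<phi> (x + L) = \<phi> x) \<and> continuous_on UNIV \<phi>"
  by (simp add: periodic_C_def)

text \<open>Turns the definition by iterated derivatives into a recursion on the order, the form in
  which inductions on smoothness use it.\<close>

lemma periodic_C_Suc:
  "periodic_C (Suc m) L \<phi> \<longleftrightarrow>
     (\<forall>x. \<phi> (x + L) = \<phi> x) \<and> (\<forall>x. \<phi> field_differentiable (at x)) \<and> periodic_C m L (deriv \<phi>)"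
proof -
  have "(\<forall>j<Suc m. (deriv ^^ j) \<phi> differentiable_on UNIV) \<longleftrightarrow>
      \<phi> differentiable_on UNIV \<and> (\<forall>j<m. (deriv ^^ j) (deriv \<phi>) differentiable_on UNIV)"
    by (metis (no_types, lifting) funpow_0 funpow_deriv_Suc less_Suc_eq_0_disj)
  moreover have "\<phi> differentiable_on UNIV \<longleftrightarrow> (\<forall>x. \<phi> field_differentiable (at x))"
    by (simp add: differentiable_on_def real_differentiable_def field_differentiable_def)
  ultimately show ?thesis
    unfolding periodic_C_def funpow_deriv_Suc using deriv_periodic[of \<phi> L] by blast
qed

lemma periodic_C_periodic: "periodic_C m L \<phi> \<Longrightarrow> \<phi> (x + L) = \<phi> x"
  by (simp add: periodic_C_def)

lemma periodic_C_field_differentiable: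
  "periodic_C m L \<phi> \<Longrightarrow> 0 < m \<Longrightarrow> \<phi> field_differentiable (at x)"
  by (cases m) (auto simp: periodic_C_Suc)

lemma periodic_C_has_deriv:
  "periodic_C m L \<phi> \<Longrightarrow> 0 < m \<Longrightarrow> (\<phi> has_real_derivative deriv \<phi> x) (at x)"
  using periodic_C_field_differentiable field_differentiable_derivI by blast

lemma periodic_C_continuous: "periodic_C m L \<phi> \<Longrightarrow> continuous_on UNIV \<phi>"
  by (cases m) (auto simp: periodic_C_Suc periodic_C_0
      intro!: continuous_at_imp_continuous_on field_differentiable_imp_continuous_at)

lemma periodic_C_mono: "periodic_C m L \<phi> \<Longrightarrow> k \<le> m \<Longrightarrow> periodic_C k L \<phi>"
proof (induction m arbitrary: k \<phi>)
  case (Suc m)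
  show ?case
  proof (cases k)
    case 0
    with Suc.prems show ?thesis
      using periodic_C_continuous[OF Suc.prems(1)] periodic_C_periodic[OF Suc.prems(1)]
      by (simp add: periodic_C_0)
  next
    case (Suc k')
    with Suc.prems Suc.IH show ?thesis by (auto simp: periodic_C_Suc)
  qed
qed simp

lemma periodic_C_deriv: "periodic_C (Suc m) L \<phi> \<Longrightarrow> periodic_C m L (deriv \<phi>)"
  by (simp add: periodic_C_Suc)

lemma periodic_C_const: "periodic_C m L (\<lambda>x. c)"
  by (induction m arbitrary: c) (auto simp: periodic_C_Suc periodic_C_0)

lemma deriv_add_fun:
  assumes "periodic_C (Suc m) L \<phi>" "periodic_C (Suc m) L \<psi>"
  shows "deriv (\<lambda>x. \<phi> x + \<psi> x) = (\<lambda>x. deriv \<phi> x + deriv \<psi> x)"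
  using assms by (auto simp: periodic_C_Suc fun_eq_iff)

lemma deriv_mult_fun:
  assumes "periodic_C (Suc m) L \<phi>" "periodic_C (Suc m) L \<psi>"
  shows "deriv (\<lambda>x. \<phi> x * \<psi> x) = (\<lambda>x. \<phi> x * deriv \<psi> x + deriv \<phi> x * \<psi> x)"
  using assms by (auto simp: periodic_C_Suc fun_eq_iff)

lemma periodic_C_add:
  "periodic_C m L \<phi> \<Longrightarrow> periodic_C m L \<psi> \<Longrightarrow> periodic_C m L (\<lambda>x. \<phi> x + \<psi> x)"
proof (induction m arbitrary: \<phi> \<psi>)
  case (Suc m)
  from Suc.prems Suc.IH[of "deriv \<phi>" "deriv \<psi>"] show ?case
    unfolding periodic_C_Suc[of m L "\<lambda>x. \<phi> x + \<psi> x"] deriv_add_fun[OF Suc.prems]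
    by (auto simp: periodic_C_Suc intro!: derivative_intros)
qed (auto simp: periodic_C_0 intro!: continuous_intros)

lemma periodic_C_mult:
  "periodic_C m L \<phi> \<Longrightarrow> periodic_C m L \<psi> \<Longrightarrow> periodic_C m L (\<lambda>x. \<phi> x * \<psi> x)"
proof (induction m arbitrary: \<phi> \<psi>)
  case (Suc m)
  have "periodic_C m L \<phi>" "periodic_C m L \<psi>"
    using Suc.prems periodic_C_mono[of "Suc m" L _ m] by auto
  then have "periodic_C m L (\<lambda>x. \<phi> x * deriv \<psi> x + deriv \<phi> x * \<psi> x)"
    using Suc by (intro periodic_C_add Suc.IH) (auto simp: periodic_C_Suc)
  with Suc.prems show ?case
    unfolding periodic_C_Suc[of m L "\<lambda>x. \<phi> x * \<psi> x"] deriv_mult_fun[OF Suc.prems]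
    by (auto simp: periodic_C_Suc intro!: derivative_intros)
qed (auto simp: periodic_C_0 intro!: continuous_intros)

lemma periodic_C_cmult: "periodic_C m L \<phi> \<Longrightarrow> periodic_C m L (\<lambda>x. c * \<phi> x)"
  by (intro periodic_C_mult periodic_C_const)

lemma periodic_C_divide: "periodic_C m L \<phi> \<Longrightarrow> periodic_C m L (\<lambda>x. \<phi> x / c)"
  using periodic_C_cmult[of m L \<phi> "1 / c"] by simp

lemma periodic_C_minus: "periodic_C m L \<phi> \<Longrightarrow> periodic_C m L (\<lambda>x. - \<phi> x)"
  using periodic_C_cmult[of m L \<phi> "- 1"] by simp

lemma periodic_C_diff:
  "periodic_C m L \<phi> \<Longrightarrow> periodic_C m L \<psi> \<Longrightarrow> periodic_C m L (\<lambda>x. \<phi> x - \<psi> x)"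
  using periodic_C_add[of m L \<phi> "\<lambda>x. - \<psi> x"] periodic_C_minus by simp

lemma periodic_C_sum:
  "(\<And>i. i \<in> I \<Longrightarrow> periodic_C m L (\<phi> i)) \<Longrightarrow> periodic_C m L (\<lambda>x. \<Sum>i\<in>I. \<phi> i x)"
  by (induction I rule: infinite_finite_induct) (auto intro: periodic_C_const periodic_C_add)

lemmas periodic_C_intros = periodic_C_const periodic_C_add periodic_C_diff periodic_C_minus
  periodic_C_mult periodic_C_divide periodic_C_sum

section \<open>Extrema of periodic functions\<close>

lemma periodic_shift_int:
  fixes \<phi> :: "real \<Rightarrow> 'a"
  assumes "\<And>x. \<phi> (x + L) = \<phi> x"
  shows "\<phi> (x + of_int k * L) = \<phi> x"
proof (induction k arbitrary: x rule: int_induct[where k = 0])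
  case (step1 i)
  then show ?case using assms[of "x + of_int i * L"] by (simp add: algebra_simps)
next
  case (step2 i)
  then show ?case using assms[of "x + (of_int i - 1) * L"] by (simp add: algebra_simps)
qed simp

text \<open>Compactness of one period gives a maximum there; a shift by a multiple of
  \<open>L\<close> brings every point into that period.\<close>

lemma periodic_attains_sup:
  fixes \<phi> :: "real \<Rightarrow> real"
  assumes "0 < L" "periodic_C 0 L \<phi>"
  obtains x0 where "\<And>x. \<phi> x \<le> \<phi> x0"
proof -
  have per: "\<phi> (x + L) = \<phi> x" and cont: "continuous_on UNIV \<phi>" for x
    using assms by (auto simp: periodic_C_0)
  have "\<exists>x0\<in>{0..L}. \<forall>y\<in>{0..L}. \<phi> y \<le> \<phi> x0"
    using \<open>0 < L\<close> by (intro continuous_attains_sup) (auto intro: continuous_on_subset[OF cont])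
  then obtain x0 where x0: "\<forall>y\<in>{0..L}. \<phi> y \<le> \<phi> x0" by blast
  have "\<phi> x \<le> \<phi> x0" for x
  proof -
    define k where "k = \<lfloor>x / L\<rfloor>"
    have "of_int k * L \<le> x" "x \<le> of_int k * L + L"
      using floor_divide_lower[OF \<open>0 < L\<close>, of x] floor_divide_upper[OF \<open>0 < L\<close>, of x]
      by (simp_all add: k_def algebra_simps)
    then have "\<phi> (x + of_int (- k) * L) \<le> \<phi> x0"
      using x0 by auto
    then show ?thesis
      using periodic_shift_int[where \<phi> = \<phi>, OF per, of x "- k"] by simp
  qed
  then show ?thesis using that by blast
qed

lemma periodic_attains_abs_sup:
  fixes \<phi> :: "real \<Rightarrow> real"
  assumes "0 < L" "periodic_C m L \<phi>"
  obtains x0 where "\<And>x. \<bar>\<phi> x\<bar> \<le> \<bar>\<phi> x0\<bar>"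
proof -
  have "periodic_C 0 L (\<lambda>x. \<bar>\<phi> x\<bar>)"
    using periodic_C_mono[OF assms(2), of 0] by (auto simp: periodic_C_0 intro: continuous_intros)
  from periodic_attains_sup[OF assms(1) this] that show ?thesis by blast
qed

section \<open>Closed balls for the C^m norm (largest sup of a derivative up to order m), with
  smoothness built in\<close>

definition C_le :: "nat \<Rightarrow> real \<Rightarrow> real \<Rightarrow> (real \<Rightarrow> real) \<Rightarrow> bool" where
  "C_le m L B \<phi> \<longleftrightarrow> periodic_C m L \<phi> \<and> (\<forall>k\<le>m. \<forall>x. \<bar>(deriv ^^ k) \<phi> x\<bar> \<le> B)"

lemma C_le_0: "C_le 0 L B \<phi> \<longleftrightarrow> periodic_C 0 L \<phi> \<and> (\<forall>x. \<bar>\<phi> x\<bar> \<le> B)"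
  by (simp add: C_le_def)

lemma C_le_Suc:
  "C_le (Suc m) L B \<phi> \<longleftrightarrow> periodic_C (Suc m) L \<phi> \<and> (\<forall>x. \<bar>\<phi> x\<bar> \<le> B) \<and> C_le m L B (deriv \<phi>)"
proof -
  have "(\<forall>k\<le>Suc m. \<forall>x. \<bar>(deriv ^^ k) \<phi> x\<bar> \<le> B) \<longleftrightarrow>
      (\<forall>x. \<bar>\<phi> x\<bar> \<le> B) \<and> (\<forall>k\<le>m. \<forall>x. \<bar>(deriv ^^ k) (deriv \<phi>) x\<bar> \<le> B)"
    unfolding less_Suc_eq_le[symmetric] by (subst All_less_Suc2) (simp only: funpow_deriv_Suc funpow_0)
  then show ?thesis
    unfolding C_le_def by (auto simp: periodic_C_Suc)
qed

lemma C_le_periodic_C: "C_le m L B \<phi> \<Longrightarrow> periodic_C m L \<phi>"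
  by (simp add: C_le_def)

lemma C_le_abs: "C_le m L B \<phi> \<Longrightarrow> \<bar>\<phi> x\<bar> \<le> B"
  unfolding C_le_def by (metis funpow_0 le0)

lemma C_le_nonneg: "C_le m L B \<phi> \<Longrightarrow> 0 \<le> B"
  using C_le_abs[of m L B \<phi> 0] by linarith

lemma C_le_mono: "C_le m L B \<phi> \<Longrightarrow> k \<le> m \<Longrightarrow> B \<le> B' \<Longrightarrow> C_le k L B' \<phi>"
  unfolding C_le_def by (meson order_trans periodic_C_mono)

lemma C_le_ex:
  assumes "0 < L" "periodic_C m L \<phi>"
  shows "\<exists>B. C_le m L B \<phi>"
  using assms(2)
proof (induction m arbitrary: \<phi>)
  case 0
  then show ?case using periodic_attains_abs_sup[OF assms(1)] by (metis C_le_0)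
next
  case (Suc m)
  then obtain B where B: "C_le m L B (deriv \<phi>)"
    using periodic_C_deriv by blast
  obtain x0 where x0: "\<And>x. \<bar>\<phi> x\<bar> \<le> \<bar>\<phi> x0\<bar>"
    using periodic_attains_abs_sup[OF assms(1) Suc.prems] by blast
  have "C_le (Suc m) L (max B \<bar>\<phi> x0\<bar>) \<phi>"
    using Suc.prems x0 C_le_mono[OF B] by (auto simp: C_le_Suc le_max_iff_disj)
  then show ?case by blast
qed

lemma C_le_add:
  "C_le m L B1 \<phi> \<Longrightarrow> C_le m L B2 \<psi> \<Longrightarrow> C_le m L (B1 + B2) (\<lambda>x. \<phi> x + \<psi> x)"
proof (induction m arbitrary: \<phi> \<psi>)
  case 0
  then show ?case
    by (auto simp: C_le_0 periodic_C_add intro: order_trans[OF abs_triangle_ineq] add_mono)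
next
  case (Suc m)
  have "\<bar>\<phi> x + \<psi> x\<bar> \<le> B1 + B2" for x
    using C_le_abs[OF Suc.prems(1), of x] C_le_abs[OF Suc.prems(2), of x] by linarith
  with Suc show ?case
    by (auto simp: C_le_Suc periodic_C_add deriv_add_fun)
qed

text \<open>The factor \<open>2 ^ m\<close> counts Leibniz terms: each derivative turns one product
  into two.\<close>

lemma C_le_mult:
  "C_le m L B1 \<phi> \<Longrightarrow> C_le m L B2 \<psi> \<Longrightarrow> C_le m L (2 ^ m * (B1 * B2)) (\<lambda>x. \<phi> x * \<psi> x)"
proof (induction m arbitrary: \<phi> \<psi>)
  case 0
  then show ?case
    by (auto simp: C_le_0 periodic_C_mult abs_mult intro!: mult_mono intro: order_trans[OF abs_ge_zero])
next
  case (Suc m)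
  have pos: "0 \<le> B1" "0 \<le> B2" using Suc.prems C_le_nonneg by blast+
  have "C_le m L (2 ^ m * (B1 * B2) + 2 ^ m * (B1 * B2)) (\<lambda>x. \<phi> x * deriv \<psi> x + deriv \<phi> x * \<psi> x)"
    using Suc.prems C_le_mono[OF Suc.prems(1), of m B1] C_le_mono[OF Suc.prems(2), of m B2]
    by (intro C_le_add Suc.IH) (auto simp: C_le_Suc)
  moreover have "\<bar>\<phi> x * \<psi> x\<bar> \<le> 2 ^ Suc m * (B1 * B2)" for x
  proof -
    have "\<bar>\<phi> x * \<psi> x\<bar> \<le> 1 * (B1 * B2)"
      using mult_mono[OF C_le_abs[OF Suc.prems(1)] C_le_abs[OF Suc.prems(2)] pos(1) abs_ge_zero]
      by (simp add: abs_mult)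
    also have "\<dots> \<le> 2 ^ Suc m * (B1 * B2)"
      using pos by (intro mult_right_mono one_le_power) auto
    finally show ?thesis .
  qed
  moreover have "2 ^ m * (B1 * B2) + 2 ^ m * (B1 * B2) = 2 ^ Suc m * (B1 * B2)"
    by simp
  moreover note deriv_mult_fun[OF Suc.prems[THEN C_le_periodic_C]]
  ultimately show ?case
    using periodic_C_mult[OF Suc.prems[THEN C_le_periodic_C]] by (simp only: C_le_Suc simp_thms)
qed

section \<open>Convergence with derivatives\<close>

text \<open>Norm convergence in C^m as \<open>\<epsilon>\<close> decreases to 0. Smoothness is asked
  of the limit and, for small \<open>\<epsilon>\<close> only, of the differences, because the
  numerical solutions are given only for such \<open>\<epsilon>\<close>.\<close>

definition C_tendsto :: "nat \<Rightarrow> real \<Rightarrow> (real \<Rightarrow> real \<Rightarrow> real) \<Rightarrow> (real \<Rightarrow> real) \<Rightarrow> bool" where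
  "C_tendsto m L \<phi> \<Phi> \<longleftrightarrow>
     periodic_C m L \<Phi> \<and> (\<forall>e>0. \<forall>\<^sub>F \<epsilon> in at_right 0. C_le m L e (\<lambda>x. \<phi> \<epsilon> x - \<Phi> x))"

lemma C_tendsto_limit: "C_tendsto m L \<phi> \<Phi> \<Longrightarrow> periodic_C m L \<Phi>"
  by (simp add: C_tendsto_def)

lemma C_tendsto_eventually:
  "C_tendsto m L \<phi> \<Phi> \<Longrightarrow> 0 < e \<Longrightarrow> \<forall>\<^sub>F \<epsilon> in at_right 0. C_le m L e (\<lambda>x. \<phi> \<epsilon> x - \<Phi> x)"
  by (simp add: C_tendsto_def)

lemma C_tendsto_cong:
  assumes "C_tendsto m L \<phi> \<Phi>" "\<forall>\<^sub>F \<epsilon> in at_right 0. \<forall>x. \<psi> \<epsilon> x = \<phi> \<epsilon> x"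
  shows "C_tendsto m L \<psi> \<Phi>"
  unfolding C_tendsto_def
proof (intro conjI allI impI)
  fix e :: real assume "0 < e"
  show "\<forall>\<^sub>F \<epsilon> in at_right 0. C_le m L e (\<lambda>x. \<psi> \<epsilon> x - \<Phi> x)"
    using C_tendsto_eventually[OF assms(1) \<open>0 < e\<close>] assms(2) by eventually_elim simp
qed (rule C_tendsto_limit[OF assms(1)])

lemma C_tendsto_mono:
  assumes "C_tendsto m L \<phi> \<Phi>" "k \<le> m"
  shows "C_tendsto k L \<phi> \<Phi>"
  unfolding C_tendsto_def
proof (intro conjI allI impI)
  fix e :: real assume "0 < e"
  from C_tendsto_eventually[OF assms(1) this]
  show "\<forall>\<^sub>F \<epsilon> in at_right 0. C_le k L e (\<lambda>x. \<phi> \<epsilon> x - \<Phi> x)"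
    by (rule eventually_mono) (erule C_le_mono[OF _ assms(2) order_refl])
qed (rule periodic_C_mono[OF C_tendsto_limit[OF assms(1)] assms(2)])

lemma C_tendsto_eventually_periodic_C:
  assumes "C_tendsto m L \<phi> \<Phi>"
  shows "\<forall>\<^sub>F \<epsilon> in at_right 0. periodic_C m L (\<phi> \<epsilon>)"
  using C_tendsto_eventually[OF assms, of 1, simplified]
proof eventually_elim
  case (elim \<epsilon>)
  from periodic_C_add[OF C_le_periodic_C[OF this] C_tendsto_limit[OF assms]] show ?case by simp
qed

lemma C_tendsto_uniform_limit:
  assumes "C_tendsto m L \<phi> \<Phi>"
  shows "uniform_limit UNIV \<phi> \<Phi> (at_right 0)"
  unfolding uniform_limit_iff
proof (intro allI impI)
  fix e :: real assume "0 < e"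
  then have "\<forall>\<^sub>F \<epsilon> in at_right 0. C_le m L (e / 2) (\<lambda>x. \<phi> \<epsilon> x - \<Phi> x)"
    by (intro C_tendsto_eventually[OF assms]) simp
  then show "\<forall>\<^sub>F \<epsilon> in at_right 0. \<forall>x\<in>UNIV. dist (\<phi> \<epsilon> x) (\<Phi> x) < e"
  proof eventually_elim
    case (elim \<epsilon>)
    show ?case
      using C_le_abs[OF elim] \<open>0 < e\<close> by (auto simp: dist_real_def intro: le_less_trans[of _ "e / 2"])
  qed
qed

lemma C_tendsto_const: "periodic_C m L \<Phi> \<Longrightarrow> C_tendsto m L (\<lambda>\<epsilon>. \<Phi>) \<Phi>"
  unfolding C_tendsto_def
proof (intro conjI allI impI always_eventually)
  fix e :: real assume "0 < e"
  have "C_le m L e (\<lambda>x. 0)"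
    using \<open>0 < e\<close> by (induction m) (auto simp: C_le_Suc C_le_0 periodic_C_const)
  then show "C_le m L e (\<lambda>x. \<Phi> x - \<Phi> x)" by simp
qed

text \<open>Treats coefficients depending on \<open>\<epsilon>\<close> as constant functions, so
  that \<open>C_tendsto_mult\<close> covers them.\<close>

lemma C_tendsto_scalar:
  assumes "(g \<longlongrightarrow> g0) (at_right 0)"
  shows "C_tendsto m L (\<lambda>\<epsilon> x. g \<epsilon>) (\<lambda>x. g0)"
  unfolding C_tendsto_def
proof (intro conjI allI impI)
  fix e :: real assume "0 < e"
  have *: "C_le m L e (\<lambda>x. c)" if "\<bar>c\<bar> \<le> e" for c :: real
    using that by (induction m arbitrary: c) (auto simp: C_le_Suc C_le_0 periodic_C_const)
  have "\<forall>\<^sub>F \<epsilon> in at_right 0. dist (g \<epsilon>) g0 < e"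
    using assms \<open>0 < e\<close> by (rule tendstoD)
  then show "\<forall>\<^sub>F \<epsilon> in at_right 0. C_le m L e (\<lambda>x. g \<epsilon> - g0)"
    by eventually_elim (rule *, simp add: dist_real_def)
qed (rule periodic_C_const)

lemma C_tendsto_add:
  assumes "C_tendsto m L \<phi> \<Phi>" "C_tendsto m L \<psi> \<Psi>"
  shows "C_tendsto m L (\<lambda>\<epsilon> x. \<phi> \<epsilon> x + \<psi> \<epsilon> x) (\<lambda>x. \<Phi> x + \<Psi> x)"
  unfolding C_tendsto_def
proof (intro conjI allI impI)
  fix e :: real assume "0 < e"
  then have "0 < e / 2" by simp
  show "\<forall>\<^sub>F \<epsilon> in at_right 0. C_le m L e (\<lambda>x. \<phi> \<epsilon> x + \<psi> \<epsilon> x - (\<Phi> x + \<Psi> x))"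
    using C_tendsto_eventually[OF assms(1) \<open>0 < e / 2\<close>] C_tendsto_eventually[OF assms(2) \<open>0 < e / 2\<close>]
  proof eventually_elim
    case (elim \<epsilon>)
    then show ?case using C_le_add[OF elim] by (simp add: algebra_simps)
  qed
qed (use assms in \<open>auto intro: periodic_C_add C_tendsto_limit\<close>)

lemma C_tendsto_mult:
  assumes "0 < L" "C_tendsto m L \<phi> \<Phi>" "C_tendsto m L \<psi> \<Psi>"
  shows "C_tendsto m L (\<lambda>\<epsilon> x. \<phi> \<epsilon> x * \<psi> \<epsilon> x) (\<lambda>x. \<Phi> x * \<Psi> x)"
  unfolding C_tendsto_def
proof (intro conjI allI impI)
  fix e :: real assume "0 < e"
  obtain B1 B2 where B: "C_le m L B1 \<Phi>" "C_le m L B2 \<Psi>"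
    using C_le_ex assms C_tendsto_limit by metis
  then have pos: "0 \<le> B1" "0 \<le> B2" using C_le_nonneg by blast+
  \<comment> \<open>The error of the product is \<open>a * b + \<Phi> * b + a * \<Psi>\<close> with
    \<open>a\<close>, \<open>b\<close> of size \<open>d\<close>. Since \<open>d \<le> 1\<close>
    gives \<open>d * d \<le> d\<close>, it is at most
    \<open>2 ^ m * (1 + B1 + B2) * d\<close>.\<close>
  define d where "d = min 1 (e / (2 ^ m * (1 + B1 + B2)))"
  have d: "0 < d" "d \<le> 1"
    unfolding d_def using pos \<open>0 < e\<close> by auto
  have "2 ^ m * (d * d) + (2 ^ m * (B1 * d) + 2 ^ m * (d * B2)) = 2 ^ m * (d + B1 + B2) * d"
    by (simp add: algebra_simps)
  also have "\<dots> \<le> 2 ^ m * (1 + B1 + B2) * (e / (2 ^ m * (1 + B1 + B2)))"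
    using d pos by (intro mult_mono) (auto simp: d_def)
  also have "\<dots> = e" using pos by simp
  finally have le: "2 ^ m * (d * d) + (2 ^ m * (B1 * d) + 2 ^ m * (d * B2)) \<le> e" .
  show "\<forall>\<^sub>F \<epsilon> in at_right 0. C_le m L e (\<lambda>x. \<phi> \<epsilon> x * \<psi> \<epsilon> x - \<Phi> x * \<Psi> x)"
    using C_tendsto_eventually[OF assms(2) d(1)] C_tendsto_eventually[OF assms(3) d(1)]
  proof eventually_elim
    case (elim \<epsilon>)
    let ?a = "\<lambda>x. \<phi> \<epsilon> x - \<Phi> x" and ?b = "\<lambda>x. \<psi> \<epsilon> x - \<Psi> x"
    have "C_le m L e (\<lambda>x. ?a x * ?b x + (\<Phi> x * ?b x + ?a x * \<Psi> x))"
      by (rule C_le_mono[OF C_le_add[OF C_le_mult C_le_add[OF C_le_mult C_le_mult]] order_refl le])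
        (use elim B in auto)
    then show ?case by (simp add: algebra_simps)
  qed
qed (use assms in \<open>auto intro: periodic_C_mult C_tendsto_limit\<close>)

lemma C_tendsto_cmult:
  "0 < L \<Longrightarrow> C_tendsto m L \<phi> \<Phi> \<Longrightarrow> C_tendsto m L (\<lambda>\<epsilon> x. c * \<phi> \<epsilon> x) (\<lambda>x. c * \<Phi> x)"
  by (intro C_tendsto_mult C_tendsto_const periodic_C_const)

lemma C_tendsto_diff:
  assumes "0 < L" "C_tendsto m L \<phi> \<Phi>" "C_tendsto m L \<psi> \<Psi>"
  shows "C_tendsto m L (\<lambda>\<epsilon> x. \<phi> \<epsilon> x - \<psi> \<epsilon> x) (\<lambda>x. \<Phi> x - \<Psi> x)"
  using C_tendsto_add[OF assms(2) C_tendsto_cmult[OF assms(1,3), of "- 1"]] by simp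

lemma C_tendsto_sum:
  "(\<And>i. i \<in> I \<Longrightarrow> C_tendsto m L (\<phi> i) (\<Phi> i)) \<Longrightarrow>
   C_tendsto m L (\<lambda>\<epsilon> x. \<Sum>i\<in>I. \<phi> i \<epsilon> x) (\<lambda>x. \<Sum>i\<in>I. \<Phi> i x)"
  by (induction I rule: infinite_finite_induct)
    (auto intro: C_tendsto_const periodic_C_const C_tendsto_add)

lemma deriv_diff_fun:
  assumes "periodic_C (Suc m) L \<phi>" "periodic_C (Suc m) L \<psi>"
  shows "deriv (\<lambda>x. \<phi> x - \<psi> x) = (\<lambda>x. deriv \<phi> x - deriv \<psi> x)"
  using assms by (auto simp: periodic_C_Suc fun_eq_iff)

lemma C_tendsto_deriv:
  assumes "C_tendsto (Suc m) L \<phi> \<Phi>"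
  shows "C_tendsto m L (\<lambda>\<epsilon>. deriv (\<phi> \<epsilon>)) (deriv \<Phi>)"
  unfolding C_tendsto_def
proof (intro conjI allI impI)
  fix e :: real assume "0 < e"
  show "\<forall>\<^sub>F \<epsilon> in at_right 0. C_le m L e (\<lambda>x. deriv (\<phi> \<epsilon>) x - deriv \<Phi> x)"
    using C_tendsto_eventually[OF assms \<open>0 < e\<close>] C_tendsto_eventually_periodic_C[OF assms]
  proof eventually_elim
    case (elim \<epsilon>)
    then show ?case
      using deriv_diff_fun[OF elim(2) C_tendsto_limit[OF assms]] by (simp add: C_le_Suc)
  qed
qed (use assms in \<open>auto intro: periodic_C_deriv C_tendsto_limit\<close>)

section \<open>Maximum principles\<close>

text \<open>Otherwise the first derivative, zero at \<open>x0\<close>, would be positive just to the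
  right, and the mean value theorem would produce a value above the maximum.\<close>

lemma deriv2_nonpos_at_max:
  assumes "periodic_C 2 L \<phi>" "\<And>x. \<phi> x \<le> \<phi> x0"
  shows "deriv (deriv \<phi>) x0 \<le> 0"
proof (rule ccontr)
  assume "\<not> ?thesis"
  then have pos: "0 < deriv (deriv \<phi>) x0" by simp
  have d1: "(\<phi> has_real_derivative deriv \<phi> x) (at x)" for x
    using assms(1) by (rule periodic_C_has_deriv) simp
  have d2: "(deriv \<phi> has_real_derivative deriv (deriv \<phi>) x) (at x)" for x
    using assms(1) by (intro periodic_C_has_deriv[of 1 L] periodic_C_deriv) (simp_all add: numeral_2_eq_2)
  have zero: "deriv \<phi> x0 = 0"
    by (rule DERIV_local_max[OF d1, of 1]) (use assms(2) in auto)
  obtain d where d: "0 < d" "\<And>h. 0 < h \<Longrightarrow> h < d \<Longrightarrow> deriv \<phi> x0 < deriv \<phi> (x0 + h)"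
    using DERIV_pos_inc_right[OF d2 pos] by blast
  obtain z where z: "x0 < z" "z < x0 + d / 2" "\<phi> (x0 + d / 2) - \<phi> x0 = (x0 + d / 2 - x0) * deriv \<phi> z"
    using MVT2[of x0 "x0 + d / 2" \<phi> "deriv \<phi>"] d1 d(1) by auto
  have "0 < deriv \<phi> z"
    using d(2)[of "z - x0"] z zero by simp
  with d(1) have "0 < d * deriv \<phi> z" by simp
  moreover have "\<phi> (x0 + d / 2) - \<phi> x0 = d * deriv \<phi> z / 2"
    using z(3) by simp
  ultimately have "\<phi> x0 < \<phi> (x0 + d / 2)" by linarith
  then show False using assms(2)[of "x0 + d / 2"] by simp
qed

lemma deriv2_nonneg_at_min:
  assumes "periodic_C 2 L \<phi>" "\<And>x. \<phi> x0 \<le> \<phi> x"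
  shows "0 \<le> deriv (deriv \<phi>) x0"
proof -
  have "periodic_C 1 L (deriv \<phi>)"
    using assms(1) by (auto simp: numeral_2_eq_2 intro: periodic_C_deriv)
  then have "deriv (\<lambda>x. - \<phi> x) = (\<lambda>x. - deriv \<phi> x)"
    and "deriv (\<lambda>x. - deriv \<phi> x) = (\<lambda>x. - deriv (deriv \<phi>) x)"
    using periodic_C_field_differentiable[OF assms(1)] periodic_C_field_differentiable[of 1 L "deriv \<phi>"]
    by (auto simp: fun_eq_iff)
  with deriv2_nonpos_at_max[OF periodic_C_minus[OF assms(1)], of x0] assms(2) show ?thesis
    by simp
qed

text \<open>Common core of both maximum principles: a periodic function attains its extrema, so a
  sup bound has to be checked only at points where the derivative vanishes.\<close>

lemma abs_le_by_extrema:
  assumes "0 < L" "0 < \<kappa>" "periodic_C (Suc m) L \<phi>"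
    and max: "\<And>x0. (\<And>x. \<phi> x \<le> \<phi> x0) \<Longrightarrow> deriv \<phi> x0 = 0 \<Longrightarrow> \<kappa> * \<phi> x0 \<le> B"
    and min: "\<And>x0. (\<And>x. \<phi> x0 \<le> \<phi> x) \<Longrightarrow> deriv \<phi> x0 = 0 \<Longrightarrow> - B \<le> \<kappa> * \<phi> x0"
  shows "\<bar>\<phi> x\<bar> \<le> B / \<kappa>"
proof -
  note D = periodic_C_has_deriv[OF assms(3) zero_less_Suc]
  obtain x1 where x1: "\<And>x. \<phi> x \<le> \<phi> x1"
    using periodic_attains_sup[OF \<open>0 < L\<close> periodic_C_mono[OF assms(3) le0]] by blast
  have "deriv \<phi> x1 = 0"
    by (rule DERIV_local_max[OF D, of 1]) (use x1 in auto)
  with max x1 have "\<kappa> * \<phi> x1 \<le> B" by blast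
  with \<open>0 < \<kappa>\<close> have 1: "\<phi> x1 \<le> B / \<kappa>" by (simp add: field_simps)
  obtain x2 where x2: "\<And>x. - \<phi> x \<le> - \<phi> x2"
    using periodic_attains_sup[OF \<open>0 < L\<close> periodic_C_minus[OF periodic_C_mono[OF assms(3) le0]]] by blast
  then have x2: "\<phi> x2 \<le> \<phi> x" for x using neg_le_iff_le by blast
  have "deriv \<phi> x2 = 0"
    by (rule DERIV_local_min[OF D, of 1]) (use x2 in auto)
  with min x2 have "- B \<le> \<kappa> * \<phi> x2" by blast
  with \<open>0 < \<kappa>\<close> have 2: "- (B / \<kappa>) \<le> \<phi> x2" by (simp add: field_simps)
  show ?thesis using 1 2 x1[of x] x2[of x] by linarith
qed

text \<open>At an extremum the term with \<open>\<nu>\<close> vanishes, so the bound holds for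
  either sign of \<open>\<nu>\<close> and does not degenerate as \<open>\<nu>\<close> tends to
  0.\<close>

lemma max_principle_first_order:
  assumes "0 < L" "periodic_C (Suc m) L \<phi>" "\<And>x. \<bar>\<phi> x + \<nu> * deriv \<phi> x\<bar> \<le> B"
  shows "\<bar>\<phi> x\<bar> \<le> B"
proof -
  have b: "- B \<le> \<phi> x + \<nu> * deriv \<phi> x" "\<phi> x + \<nu> * deriv \<phi> x \<le> B" for x
    using assms(3)[of x] by linarith+
  have "\<bar>\<phi> x\<bar> \<le> B / 1"
  proof (rule abs_le_by_extrema[where \<phi> = \<phi>, OF assms(1) _ assms(2)])
    show "0 < (1 :: real)" by simp
    fix x0 assume "deriv \<phi> x0 = 0"
    with b[of x0] show "1 * \<phi> x0 \<le> B" "- B \<le> 1 * \<phi> x0" by simp_all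
  qed
  then show ?thesis by simp
qed

lemma max_principle_second_order:
  assumes "0 < L" "0 < \<kappa>" "0 \<le> \<mu>" "periodic_C 2 L \<phi>"
    and eq: "\<And>x. \<bar>\<kappa> * \<phi> x - \<mu> * deriv (deriv \<phi>) x\<bar> \<le> B"
  shows "\<bar>\<phi> x\<bar> \<le> B / \<kappa>"
proof (rule abs_le_by_extrema[where \<phi> = \<phi>, OF assms(1,2)])
  show "periodic_C (Suc 1) L \<phi>" using assms(4) by (simp add: numeral_2_eq_2)
  fix x0
  have b: "- B \<le> \<kappa> * \<phi> x0 - \<mu> * deriv (deriv \<phi>) x0" "\<kappa> * \<phi> x0 - \<mu> * deriv (deriv \<phi>) x0 \<le> B"
    using eq[of x0] by linarith+
  show "\<kappa> * \<phi> x0 \<le> B" if "\<And>x. \<phi> x \<le> \<phi> x0"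
    using mult_nonneg_nonpos[OF assms(3) deriv2_nonpos_at_max[OF assms(4) that]] b by linarith
  show "- B \<le> \<kappa> * \<phi> x0" if "\<And>x. \<phi> x0 \<le> \<phi> x"
    using mult_nonneg_nonneg[OF assms(3) deriv2_nonneg_at_min[OF assms(4) that]] b by linarith
qed

text \<open>Interpolation on an interval of length 1: the derivative equals a difference of values
  somewhere in it, and changes by at most \<open>B\<close> on the way back to
  \<open>x\<close>.\<close>

lemma abs_deriv_le:
  assumes "periodic_C 2 L \<phi>" "\<And>x. \<bar>\<phi> x\<bar> \<le> A" "\<And>x. \<bar>deriv (deriv \<phi>) x\<bar> \<le> B"
  shows "\<bar>deriv \<phi> x\<bar> \<le> 2 * A + B"
proof -
  have d1: "(\<phi> has_real_derivative deriv \<phi> x) (at x)" for x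
    using assms(1) by (rule periodic_C_has_deriv) simp
  have d2: "(deriv \<phi> has_real_derivative deriv (deriv \<phi>) x) (at x)" for x
    using assms(1) by (intro periodic_C_has_deriv[of 1 L] periodic_C_deriv) (simp_all add: numeral_2_eq_2)
  obtain z where z: "x < z" "z < x + 1" "\<phi> (x + 1) - \<phi> x = (x + 1 - x) * deriv \<phi> z"
    using MVT2[of x "x + 1" \<phi> "deriv \<phi>"] d1 by auto
  obtain y where y: "deriv \<phi> z - deriv \<phi> x = (z - x) * deriv (deriv \<phi>) y"
    using MVT2[of x z "deriv \<phi>" "deriv (deriv \<phi>)"] d2 z by auto
  have "\<bar>(z - x) * deriv (deriv \<phi>) y\<bar> \<le> 1 * B"
    unfolding abs_mult using z assms(3)[of y] by (intro mult_mono) auto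
  moreover have "deriv \<phi> z = \<phi> (x + 1) - \<phi> x" using z(3) by simp
  ultimately show ?thesis
    using y assms(2)[of "x + 1"] assms(2)[of x] by linarith
qed

lemma periodic_C_Suc_if_deriv:
  assumes "periodic_C (Suc k) L \<phi>" "\<And>x. deriv \<phi> x = \<psi> x" "periodic_C m L \<psi>"
  shows "periodic_C (Suc m) L \<phi>"
proof -
  have "deriv \<phi> = \<psi>" using assms(2) by blast
  with assms(1,3) show ?thesis by (simp add: periodic_C_Suc)
qed

section \<open>The linear system of one implicit stage\<close>

text \<open>Here \<open>c\<close> is the time step times the diagonal entry, and earlier stages are
  part of \<open>F\<close>, \<open>R\<close>, \<open>K\<close>. The second equation is multiplied by
  \<open>\<epsilon>\<^sup>2\<close>, so \<open>\<epsilon> = 0\<close> is a legal value and describes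
  the limit scheme.\<close>

definition implicit_stage ::
  "real \<Rightarrow> real \<Rightarrow> real \<Rightarrow> real \<Rightarrow> real \<Rightarrow> (real \<Rightarrow> real) \<Rightarrow> (real \<Rightarrow> real) \<Rightarrow> (real \<Rightarrow> real) \<Rightarrow>
   (real \<Rightarrow> real) \<Rightarrow> (real \<Rightarrow> real) \<Rightarrow> (real \<Rightarrow> real) \<Rightarrow> bool" where
  "implicit_stage c \<epsilon> \<alpha> \<beta> \<gamma> u v w F R K \<longleftrightarrow>
     (\<forall>x. u x + c * (\<alpha> * deriv v x) = F x) \<and>
     (\<forall>x. \<epsilon>\<^sup>2 * v x + c * (\<beta> * deriv u x - w x) = R x) \<and>
     (\<forall>x. w x + c * (\<gamma> * \<epsilon>\<^sup>2 * deriv w x + v x) = K x)"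

text \<open>
  The stages are only assumed to be \<open>C\<^sup>1\<close>; each equation expresses the derivative of one unknown
  through undifferentiated terms, except that the last one is algebraic in \<open>w\<close> for \<open>\<gamma> = 0\<close>.
\<close>

lemma implicit_stage_regular:
  assumes "c \<noteq> 0" "0 < \<epsilon>" "0 < \<alpha>" "0 < \<beta>"
    and reg: "periodic_C 1 L u" "periodic_C 1 L v" "periodic_C 1 L w"
    and eq: "implicit_stage c \<epsilon> \<alpha> \<beta> \<gamma> u v w F R K"
    and rhs: "periodic_C m L F" "periodic_C m L R" "periodic_C (Suc m) L K"
  shows "periodic_C (Suc m) L u \<and> periodic_C (Suc m) L v \<and> periodic_C (Suc m) L w"
  using rhs
proof (induction m)
  case 0
  then show ?case using reg by simp
next
  case (Suc m)
  have IH: "periodic_C (Suc m) L u" "periodic_C (Suc m) L v" "periodic_C (Suc m) L w"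
    using Suc periodic_C_mono[of "Suc m" L _ m] periodic_C_mono[of "Suc (Suc m)" L _ "Suc m"] by auto
  note eqs = eq[unfolded implicit_stage_def, THEN conjunct1, rule_format]
    eq[unfolded implicit_stage_def, THEN conjunct2, THEN conjunct1, rule_format]
    eq[unfolded implicit_stage_def, THEN conjunct2, THEN conjunct2, rule_format]
  have v: "periodic_C (Suc (Suc m)) L v"
  proof (rule periodic_C_Suc_if_deriv[OF IH(2)])
    show "deriv v x = (F x - u x) / (c * \<alpha>)" for x
      using eqs(1)[of x] assms(1-4) by (simp add: field_simps)
    show "periodic_C (Suc m) L (\<lambda>x. (F x - u x) / (c * \<alpha>))"
      by (intro periodic_C_intros IH Suc.prems)
  qed
  have u: "periodic_C (Suc (Suc m)) L u"
  proof (rule periodic_C_Suc_if_deriv[OF IH(1)])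
    show "deriv u x = ((R x - \<epsilon>\<^sup>2 * v x) / c + w x) / \<beta>" for x
      using eqs(2)[of x] assms(1-4) by (simp add: field_simps)
    show "periodic_C (Suc m) L (\<lambda>x. ((R x - \<epsilon>\<^sup>2 * v x) / c + w x) / \<beta>)"
      by (intro periodic_C_intros IH Suc.prems)
  qed
  have "periodic_C (Suc (Suc m)) L w"
  proof (cases "\<gamma> = 0")
    case True
    \<comment> \<open>No derivative of \<open>w\<close> is available to integrate, so
      \<open>w\<close> is exactly as smooth as \<open>K\<close> and the improved \<open>v\<close>.
      This is why \<open>K\<close> is taken one order smoother than \<open>F\<close> and
      \<open>R\<close>.\<close>
    have "w = (\<lambda>x. K x - c * v x)"
      using eqs(3) True by (auto simp: fun_eq_iff algebra_simps)
    moreover have "periodic_C (Suc (Suc m)) L (\<lambda>x. K x - c * v x)"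
      by (intro periodic_C_intros Suc.prems v)
    ultimately show ?thesis by simp
  next
    case False
    show ?thesis
    proof (rule periodic_C_Suc_if_deriv[OF IH(3)])
      show "deriv w x = ((K x - w x) / c - v x) / (\<gamma> * \<epsilon>\<^sup>2)" for x
        using eqs(3)[of x] assms(1-4) False by (simp add: field_simps)
      show "periodic_C (Suc m) L (\<lambda>x. ((K x - w x) / c - v x) / (\<gamma> * \<epsilon>\<^sup>2))"
        by (intro periodic_C_intros IH periodic_C_mono[OF Suc.prems(3)]) simp
    qed
  qed
  with u v show ?case by simp
qed

text \<open>The coefficients are constant in \<open>x\<close>, so differentiation commutes with the
  system. The equations express the data through the unknowns, whence the data are differentiable as
  well.\<close>

lemma implicit_stage_deriv:
  assumes eq: "implicit_stage c \<epsilon> \<alpha> \<beta> \<gamma> u v w F R K"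
    and reg: "periodic_C 2 L u" "periodic_C 2 L v" "periodic_C 2 L w"
  shows "implicit_stage c \<epsilon> \<alpha> \<beta> \<gamma> (deriv u) (deriv v) (deriv w) (deriv F) (deriv R) (deriv K)"
proof -
  have F: "F = (\<lambda>x. u x + c * (\<alpha> * deriv v x))"
    and R: "R = (\<lambda>x. \<epsilon>\<^sup>2 * v x + c * (\<beta> * deriv u x - w x))"
    and K: "K = (\<lambda>x. w x + c * (\<gamma> * \<epsilon>\<^sup>2 * deriv w x + v x))"
    using eq by (simp_all add: implicit_stage_def)
  have D: "u field_differentiable (at x)" "v field_differentiable (at x)" "w field_differentiable (at x)"
    "deriv u field_differentiable (at x)" "deriv v field_differentiable (at x)"
    "deriv w field_differentiable (at x)" for x
    using reg by (auto simp: numeral_2_eq_2 periodic_C_Suc)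
  note DD = D[THEN field_differentiable_derivI]
  show ?thesis
    unfolding implicit_stage_def F R K
    by (intro conjI allI; rule sym; rule DERIV_imp_deriv)
      (auto intro!: derivative_eq_intros DD simp: algebra_simps)
qed

text \<open>An absorption argument. The equation for \<open>v\<close> has source \<open>S\<close>,
  which still contains \<open>\<epsilon>\<^sup>2 * deriv w\<close>; \<open>deriv w\<close> is
  bounded through \<open>deriv v\<close>, hence through the sup of \<open>S\<close> itself, and the
  small factor lets that part be moved to the left. No constant depends on
  \<open>\<epsilon>\<close>.\<close>

lemma implicit_stage_sup_bound:
  fixes c :: real
  defines "K1 \<equiv> 2 * (1 + 2 * \<bar>c\<bar> + c\<^sup>2)"
  assumes par: "0 < L" "c \<noteq> 0" "0 < \<epsilon>" "\<epsilon> \<le> 1" "20 * \<bar>c\<bar> * \<epsilon>\<^sup>2 \<le> 1"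
    "1 / 2 \<le> \<alpha>" "1 / 2 \<le> \<beta>" "\<alpha> \<le> 1" "\<beta> \<le> 1" "0 \<le> \<gamma>" "\<gamma> \<le> 1"
    and reg: "periodic_C 2 L u" "periodic_C 2 L v" "periodic_C 2 L w"
    and eq: "implicit_stage c \<epsilon> \<alpha> \<beta> \<gamma> u v w F R K"
    and rhs: "C_le 1 L B F" "C_le 1 L B R" "C_le 1 L B K"
  shows "\<bar>v x\<bar> \<le> K1 / c\<^sup>2 * B"
    and "\<bar>u x\<bar> \<le> (1 + 10 * \<bar>c\<bar> * K1 / c\<^sup>2) * B"
    and "\<bar>w x\<bar> \<le> (1 + \<bar>c\<bar> * K1 / c\<^sup>2) * B"
proof -
  note eq' = implicit_stage_deriv[OF eq reg]
  have e1: "u x + c * (\<alpha> * deriv v x) = F x"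
    and e2: "\<epsilon>\<^sup>2 * v x + c * (\<beta> * deriv u x - w x) = R x"
    and e3: "w x + c * (\<gamma> * \<epsilon>\<^sup>2 * deriv w x + v x) = K x"
    and e1': "deriv u x + c * (\<alpha> * deriv (deriv v) x) = deriv F x"
    and e3': "deriv w x + c * (\<gamma> * \<epsilon>\<^sup>2 * deriv (deriv w) x + deriv v x) = deriv K x" for x
    using eq eq' by (auto simp: implicit_stage_def)
  have bd: "\<bar>F x\<bar> \<le> B" "\<bar>R x\<bar> \<le> B" "\<bar>K x\<bar> \<le> B" "\<bar>deriv F x\<bar> \<le> B" "\<bar>deriv K x\<bar> \<le> B" for x
    using rhs by (auto simp: C_le_Suc C_le_0)
  have "0 \<le> B" using C_le_nonneg[OF rhs(1)] .
  have c2: "0 < c\<^sup>2" using par by simp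
  have reg': "periodic_C (Suc 1) L v" "periodic_C (Suc 1) L w" "periodic_C (Suc 0) L (deriv w)"
    "periodic_C 0 L (deriv (deriv v))"
    using reg by (auto simp: numeral_2_eq_2 periodic_C_Suc)
  define S where "S = (\<lambda>x. (\<epsilon>\<^sup>2 + c\<^sup>2) * v x - c\<^sup>2 * \<alpha> * \<beta> * deriv (deriv v) x)"
  have "periodic_C 0 L S"
    unfolding S_def by (intro periodic_C_intros reg' periodic_C_mono[OF reg'(1)]) simp
  then obtain x0 where x0: "\<And>x. \<bar>S x\<bar> \<le> \<bar>S x0\<bar>"
    using periodic_attains_abs_sup[OF \<open>0 < L\<close>] by blast
  \<comment> \<open>The sup of \<open>S\<close>, attained at \<open>x0\<close>. Everything is first
    bounded by \<open>P\<close> and \<open>B\<close>; evaluating \<open>S\<close> at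
    \<open>x0\<close> then bounds \<open>P\<close> by \<open>B\<close>.\<close>
  define P where "P = \<bar>S x0\<bar>"
  have P: "\<bar>S x\<bar> \<le> P" "0 \<le> P" for x
    using x0 by (auto simp: P_def)
  have ab: "1 / 4 \<le> \<alpha> * \<beta>"
    using mult_mono[of "1/2" \<alpha> "1/2" \<beta>] par by simp
  have mu: "0 \<le> c\<^sup>2 * \<alpha> * \<beta>"
    using par by simp
  have v0: "\<bar>v x\<bar> \<le> P / (\<epsilon>\<^sup>2 + c\<^sup>2)" for x
    using P(1) mu c2 by (intro max_principle_second_order[OF \<open>0 < L\<close> _ mu reg(2)])
      (auto simp: S_def add_pos_pos add_nonneg_pos)
  have v: "\<bar>v x\<bar> \<le> P / c\<^sup>2" for x
    using c2 P(2) by (intro order_trans[OF v0] divide_left_mono) (auto simp: add_pos_pos add_nonneg_pos)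
  \<comment> \<open>The equation leaves \<open>2 * P\<close> for the second-order term, whose
    coefficient is at least \<open>c\<^sup>2 / 4\<close>; hence the 8.\<close>
  have v2: "\<bar>deriv (deriv v) x\<bar> \<le> 8 * P / c\<^sup>2" for x
  proof -
    have pos: "0 < \<epsilon>\<^sup>2 + c\<^sup>2" using c2 by (simp add: add_nonneg_pos)
    then have "(\<epsilon>\<^sup>2 + c\<^sup>2) * \<bar>v x\<bar> \<le> P"
      using v0[of x] by (simp add: field_simps)
    then have "\<bar>(\<epsilon>\<^sup>2 + c\<^sup>2) * v x\<bar> \<le> P"
      using pos by (simp add: abs_mult)
    then have "\<bar>c\<^sup>2 * \<alpha> * \<beta> * deriv (deriv v) x\<bar> \<le> 2 * P"
      using P(1)[of x] unfolding S_def by linarith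
    then have *: "c\<^sup>2 * (\<alpha> * \<beta>) * \<bar>deriv (deriv v) x\<bar> \<le> 2 * P"
      using par by (simp add: abs_mult mult.assoc)
    have "c\<^sup>2 * (1 / 4) * \<bar>deriv (deriv v) x\<bar> \<le> c\<^sup>2 * (\<alpha> * \<beta>) * \<bar>deriv (deriv v) x\<bar>"
      using ab c2 by (intro mult_right_mono mult_left_mono) auto
    with * c2 show ?thesis by (simp add: field_simps)
  qed
  \<comment> \<open>Interpolation gives 2 * 1 + 8 = 10.\<close>
  have v1: "\<bar>deriv v x\<bar> \<le> 10 * P / c\<^sup>2" for x
    using abs_deriv_le[OF reg(2) v v2, of x] by simp
  have cv1: "\<bar>c * deriv v x\<bar> \<le> \<bar>c\<bar> * (10 * P / c\<^sup>2)" for x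
    unfolding abs_mult by (intro mult_left_mono v1) auto
  \<comment> \<open>The first-order principle is applied to the differentiated third equation; its
    coefficient \<open>c * \<gamma> * \<epsilon>\<^sup>2\<close> may have either sign.\<close>
  have w1: "\<bar>deriv w x\<bar> \<le> B + \<bar>c\<bar> * (10 * P / c\<^sup>2)" for x
  proof (rule max_principle_first_order[OF \<open>0 < L\<close> reg'(3), of "c * \<gamma> * \<epsilon>\<^sup>2"])
    fix y
    have "deriv w y + c * \<gamma> * \<epsilon>\<^sup>2 * deriv (deriv w) y = deriv K y - c * deriv v y"
      using e3'[of y] by (simp add: algebra_simps)
    then show "\<bar>deriv w y + c * \<gamma> * \<epsilon>\<^sup>2 * deriv (deriv w) y\<bar> \<le> B + \<bar>c\<bar> * (10 * P / c\<^sup>2)"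
      using bd(5)[of y] cv1[of y] by linarith
  qed
  have S: "S x = R x - \<beta> * (c * deriv F x) + c * K x - c\<^sup>2 * (\<gamma> * (\<epsilon>\<^sup>2 * deriv w x))" for x
    unfolding S_def e2[symmetric] e3[symmetric] e1'[symmetric]
    by (simp add: algebra_simps power2_eq_square)
  have PB: "P \<le> K1 * B"
  proof -
    have cF: "\<bar>c * deriv F x0\<bar> \<le> \<bar>c\<bar> * B" and cK: "\<bar>c * K x0\<bar> \<le> \<bar>c\<bar> * B"
      unfolding abs_mult using bd by (auto intro: mult_left_mono)
    have bF: "\<bar>\<beta> * (c * deriv F x0)\<bar> \<le> 1 * (\<bar>c\<bar> * B)"
      unfolding abs_mult[of \<beta>] using cF par by (intro mult_mono) auto
    have ew: "\<bar>\<epsilon>\<^sup>2 * deriv w x0\<bar> \<le> \<epsilon>\<^sup>2 * (B + \<bar>c\<bar> * (10 * P / c\<^sup>2))"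
      unfolding abs_mult using w1[of x0] by (auto intro: mult_left_mono)
    have gw: "\<bar>\<gamma> * (\<epsilon>\<^sup>2 * deriv w x0)\<bar> \<le> 1 * (\<epsilon>\<^sup>2 * (B + \<bar>c\<bar> * (10 * P / c\<^sup>2)))"
      unfolding abs_mult[of \<gamma>] using ew par by (intro mult_mono) auto
    have "\<bar>c\<^sup>2 * (\<gamma> * (\<epsilon>\<^sup>2 * deriv w x0))\<bar> \<le> c\<^sup>2 * (1 * (\<epsilon>\<^sup>2 * (B + \<bar>c\<bar> * (10 * P / c\<^sup>2))))"
      unfolding abs_mult[of "c\<^sup>2"] using gw by (auto intro: mult_left_mono)
    \<comment> \<open>The assumption \<open>20 * \<bar>c\<bar> * \<epsilon>\<^sup>2 \<le> 1\<close>
      is made for this point: the contribution of \<open>P\<close> becomes at most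
      \<open>P / 2\<close>, and absorbing it accounts for the leading 2 in
      \<open>K1\<close>.\<close>
    also have "\<dots> = \<epsilon>\<^sup>2 * (c\<^sup>2 * B) + (20 * \<bar>c\<bar> * \<epsilon>\<^sup>2) * (P / 2)"
      using c2 by (simp add: field_simps)
    also have "\<dots> \<le> 1 * (c\<^sup>2 * B) + 1 * (P / 2)"
      using par \<open>0 \<le> B\<close> P(2) by (intro add_mono mult_right_mono) (auto simp: power_le_one)
    finally have "P \<le> B + \<bar>c\<bar> * B + \<bar>c\<bar> * B + (c\<^sup>2 * B + P / 2)"
      using S[of x0] bF cK bd(2)[of x0] unfolding P_def by linarith
    then show ?thesis by (simp add: K1_def algebra_simps)
  qed
  have PB': "P / c\<^sup>2 \<le> K1 / c\<^sup>2 * B"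
    using PB c2 by (simp add: divide_right_mono)
  with v show vB: "\<bar>v x\<bar> \<le> K1 / c\<^sup>2 * B" for x using order_trans by blast
  have cPB: "\<bar>c\<bar> * (P / c\<^sup>2) \<le> \<bar>c\<bar> * (K1 / c\<^sup>2 * B)"
    using PB' by (intro mult_left_mono) auto
  show "\<bar>u x\<bar> \<le> (1 + 10 * \<bar>c\<bar> * K1 / c\<^sup>2) * B"
  proof -
    have "\<bar>\<alpha> * (c * deriv v x)\<bar> \<le> 1 * (\<bar>c\<bar> * (10 * P / c\<^sup>2))"
      unfolding abs_mult[of \<alpha>] using cv1[of x] par by (intro mult_mono) auto
    moreover have "u x = F x - \<alpha> * (c * deriv v x)"
      using e1[of x] by (simp add: algebra_simps)
    ultimately have "\<bar>u x\<bar> \<le> B + 10 * (\<bar>c\<bar> * (P / c\<^sup>2))"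
      using bd(1)[of x] by (simp add: mult_ac)
    also have "\<dots> \<le> B + 10 * (\<bar>c\<bar> * (K1 / c\<^sup>2 * B))" using cPB by simp
    finally show ?thesis by (simp add: algebra_simps)
  qed
  have "\<bar>w x\<bar> \<le> B + \<bar>c\<bar> * (K1 / c\<^sup>2 * B)"
  proof (rule max_principle_first_order[OF \<open>0 < L\<close> reg'(2), of "c * \<gamma> * \<epsilon>\<^sup>2"])
    fix y
    have "\<bar>c * v y\<bar> \<le> \<bar>c\<bar> * (K1 / c\<^sup>2 * B)"
      unfolding abs_mult by (intro mult_left_mono vB) auto
    moreover have "w y + c * \<gamma> * \<epsilon>\<^sup>2 * deriv w y = K y - c * v y"
      using e3[of y] by (simp add: algebra_simps)
    ultimately show "\<bar>w y + c * \<gamma> * \<epsilon>\<^sup>2 * deriv w y\<bar> \<le> B + \<bar>c\<bar> * (K1 / c\<^sup>2 * B)"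
      using bd(3)[of y] by linarith
  qed
  then show "\<bar>w x\<bar> \<le> (1 + \<bar>c\<bar> * K1 / c\<^sup>2) * B" by (simp add: algebra_simps)
qed

text \<open>The sup bound is applied to the system and its derivatives; \<open>D\<close> dominates
  all three of its constants. It needs C^1 bounds on the data and C^2 unknowns, and the latter
  require \<open>K\<close> to be C^2. This is the loss of two derivatives.\<close>

lemma implicit_stage_C_bound:
  fixes c :: real
  defines "D \<equiv> 1 + (1 + 10 * \<bar>c\<bar>) * (2 * (1 + 2 * \<bar>c\<bar> + c\<^sup>2)) / c\<^sup>2"
  assumes par: "0 < L" "c \<noteq> 0" "0 < \<epsilon>" "\<epsilon> \<le> 1" "20 * \<bar>c\<bar> * \<epsilon>\<^sup>2 \<le> 1"
    "1 / 2 \<le> \<alpha>" "1 / 2 \<le> \<beta>" "\<alpha> \<le> 1" "\<beta> \<le> 1" "0 \<le> \<gamma>" "\<gamma> \<le> 1"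
    and reg: "periodic_C 1 L u" "periodic_C 1 L v" "periodic_C 1 L w"
    and eq: "implicit_stage c \<epsilon> \<alpha> \<beta> \<gamma> u v w F R K"
    and rhs: "C_le (m + 2) L B F" "C_le (m + 2) L B R" "C_le (m + 2) L B K"
  shows "C_le m L (D * B) u \<and> C_le m L (D * B) v \<and> C_le m L (D * B) w"
proof -
  have reg2: "periodic_C (Suc (Suc m)) L u \<and> periodic_C (Suc (Suc m)) L v \<and> periodic_C (Suc (Suc m)) L w"
    if "periodic_C 1 L u" "periodic_C 1 L v" "periodic_C 1 L w"
      and "implicit_stage c \<epsilon> \<alpha> \<beta> \<gamma> u v w F R K"
      and "C_le (m + 2) L B F" "C_le (m + 2) L B R" "C_le (m + 2) L B K" for m u v w F R K
    using that par
    by (intro implicit_stage_regular[of c \<epsilon> \<alpha> \<beta> L u v w \<gamma> F R K])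
      (auto dest!: C_le_periodic_C intro: periodic_C_mono)
  have sup: "\<bar>u x\<bar> \<le> D * B \<and> \<bar>v x\<bar> \<le> D * B \<and> \<bar>w x\<bar> \<le> D * B"
    if "periodic_C 1 L u" "periodic_C 1 L v" "periodic_C 1 L w"
      and "implicit_stage c \<epsilon> \<alpha> \<beta> \<gamma> u v w F R K"
      and "C_le (m + 2) L B F" "C_le (m + 2) L B R" "C_le (m + 2) L B K" for m u v w F R K x
  proof -
    define Q where "Q = 2 * (1 + 2 * \<bar>c\<bar> + c\<^sup>2) / c\<^sup>2"
    have Q: "0 \<le> Q" "0 \<le> \<bar>c\<bar> * Q" by (simp_all add: Q_def)
    have D: "D = 1 + Q + 10 * (\<bar>c\<bar> * Q)"
    proof -
      have "(1 + 10 * \<bar>c\<bar>) * X / c\<^sup>2 = X / c\<^sup>2 + 10 * (\<bar>c\<bar> * (X / c\<^sup>2))" for X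
        by (simp add: algebra_simps add_divide_distrib)
      then show ?thesis by (simp add: D_def Q_def)
    qed
    have B: "0 \<le> B" using that(5) C_le_nonneg by blast
    have le: "Q * B \<le> D * B" "(1 + 10 * (\<bar>c\<bar> * Q)) * B \<le> D * B" "(1 + \<bar>c\<bar> * Q) * B \<le> D * B"
      using Q by (intro mult_right_mono B; simp add: D)+
    have "periodic_C 2 L u" "periodic_C 2 L v" "periodic_C 2 L w"
      using reg2[OF that] by (auto intro: periodic_C_mono)
    moreover have "C_le 1 L B F" "C_le 1 L B R" "C_le 1 L B K"
      using that by (auto intro: C_le_mono)
    ultimately have "\<bar>v x\<bar> \<le> Q * B \<and> \<bar>u x\<bar> \<le> (1 + 10 * (\<bar>c\<bar> * Q)) * B \<and> \<bar>w x\<bar> \<le> (1 + \<bar>c\<bar> * Q) * B"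
      using implicit_stage_sup_bound[OF par _ _ _ that(4), of B x]
      by (simp add: Q_def mult.assoc)
    with le show ?thesis by (meson order_trans)
  qed
  show ?thesis
    using reg eq rhs
  \<comment> \<open>The induction hypothesis is used for the differentiated system, with the same
    \<open>B\<close> and \<open>D\<close>.\<close>
  proof (induction m arbitrary: u v w F R K)
    case (0 u v w F R K)
    show ?case
      using sup[OF 0(1-3,4) 0(5-7)] reg2[OF 0(1-4) 0(5-7)] periodic_C_mono
      by (fastforce simp: C_le_0)
  next
    case (Suc m u v w F R K)
    have reg2: "periodic_C (m + 3) L u" "periodic_C (m + 3) L v" "periodic_C (m + 3) L w"
      using reg2[OF Suc.prems(1-4) Suc.prems(5-7)] by (simp_all add: numeral_3_eq_3)
    have reg3: "periodic_C k L (deriv u)" "periodic_C k L (deriv v)" "periodic_C k L (deriv w)"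
      "periodic_C k L u" "periodic_C k L v" "periodic_C k L w" if "k \<le> m + 2" for k
      using reg2[THEN periodic_C_mono, of "Suc k"] reg2[THEN periodic_C_mono, of k] that
      by (auto simp: periodic_C_Suc)
    have rhs': "C_le (m + 2) L B (deriv F)" "C_le (m + 2) L B (deriv R)" "C_le (m + 2) L B (deriv K)"
      using Suc.prems by (auto simp: C_le_Suc)
    have "C_le m L (D * B) (deriv u) \<and> C_le m L (D * B) (deriv v) \<and> C_le m L (D * B) (deriv w)"
      by (rule Suc.IH[OF _ _ _ implicit_stage_deriv[where L = L, OF Suc.prems(4)] rhs']) (intro reg3; simp)+
    then show ?case
      using sup[OF Suc.prems(1-4) Suc.prems(5-7)] reg3[of "Suc m"] by (simp add: C_le_Suc)
  qed
qed

lemma tendsto_at_right_0_intros: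
  "((\<lambda>\<epsilon>. \<epsilon>) \<longlongrightarrow> 0) (at_right (0 :: real))"
  "((\<lambda>\<epsilon>. \<epsilon>\<^sup>2) \<longlongrightarrow> 0) (at_right (0 :: real))"
  "((\<lambda>\<epsilon>. 1 - a * \<epsilon>) \<longlongrightarrow> 1) (at_right (0 :: real))"
  by (auto intro!: tendsto_eq_intros)

text \<open>Stability plus consistency: the difference to the limit solves the same system, with the
  residual of the limit values as data. The residual contains first derivatives of \<open>U\<close>,
  \<open>V\<close>, \<open>W\<close> and is measured in C^(m+2), hence the order
  \<open>m + 3\<close> asked of them.\<close>

lemma implicit_stage_tendsto:
  assumes "0 < L" "c \<noteq> 0" "\<delta>1 \<in> {0..1}" "\<delta>2 \<in> {0..1}" "\<gamma> \<in> {0..1}"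
    and stage: "\<forall>\<^sub>F \<epsilon> in at_right 0.
      periodic_C 1 L (u \<epsilon>) \<and> periodic_C 1 L (v \<epsilon>) \<and> periodic_C 1 L (w \<epsilon>) \<and>
      implicit_stage c \<epsilon> (1 - \<delta>1 * \<epsilon>) (1 - \<delta>2 * \<epsilon>) \<gamma> (u \<epsilon>) (v \<epsilon>) (w \<epsilon>) (F \<epsilon>) (R \<epsilon>) (K \<epsilon>)"
    and rhs: "C_tendsto (m + 2) L F F0" "C_tendsto (m + 2) L R R0" "C_tendsto (m + 2) L K K0"
    and lim_reg: "periodic_C (m + 3) L U" "periodic_C (m + 3) L V" "periodic_C (m + 3) L W"
    and lim: "implicit_stage c 0 1 1 \<gamma> U V W F0 R0 K0"
  shows "C_tendsto m L u U \<and> C_tendsto m L v V \<and> C_tendsto m L w W"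
proof -
  let ?\<alpha> = "\<lambda>\<epsilon>. 1 - \<delta>1 * \<epsilon>" and ?\<beta> = "\<lambda>\<epsilon>. 1 - \<delta>2 * \<epsilon>"
  let ?u = "\<lambda>\<epsilon> x. u \<epsilon> x - U x" and ?v = "\<lambda>\<epsilon> x. v \<epsilon> x - V x" and ?w = "\<lambda>\<epsilon> x. w \<epsilon> x - W x"
  \<comment> \<open>Residuals: the data minus the left-hand sides for the actual
    \<open>\<epsilon>\<close>, evaluated at the limit values.\<close>
  let ?F = "\<lambda>\<epsilon> x. F \<epsilon> x - (U x + c * (?\<alpha> \<epsilon> * deriv V x))"
  let ?R = "\<lambda>\<epsilon> x. R \<epsilon> x - (\<epsilon>\<^sup>2 * V x + c * (?\<beta> \<epsilon> * deriv U x - W x))"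
  let ?K = "\<lambda>\<epsilon> x. K \<epsilon> x - (W x + c * (\<gamma> * \<epsilon>\<^sup>2 * deriv W x + V x))"
  have reg: "periodic_C (m + 2) L U" "periodic_C (m + 2) L V" "periodic_C (m + 2) L W"
    "periodic_C (m + 2) L (deriv U)" "periodic_C (m + 2) L (deriv V)" "periodic_C (m + 2) L (deriv W)"
    using lim_reg periodic_C_mono[of "m + 3" L _ "m + 2"] by (auto simp: numeral_3_eq_3 periodic_C_Suc)
  note intros = C_tendsto_diff C_tendsto_add C_tendsto_mult C_tendsto_const C_tendsto_scalar
    tendsto_at_right_0_intros \<open>0 < L\<close> reg rhs
  \<comment> \<open>The limits are written with explicit factors 1 and 0 to match the limit rules
    term by term; the limit system then reduces them to 0.\<close>
  have "C_tendsto (m + 2) L ?F (\<lambda>x. F0 x - (U x + c * (1 * deriv V x)))"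
    by (intro intros periodic_C_const)
  moreover have "C_tendsto (m + 2) L ?R (\<lambda>x. R0 x - (0 * V x + c * (1 * deriv U x - W x)))"
    by (intro intros periodic_C_const)
  moreover have "C_tendsto (m + 2) L ?K (\<lambda>x. K0 x - (W x + c * (\<gamma> * 0 * deriv W x + V x)))"
    by (intro intros periodic_C_const)
  ultimately have rhs': "C_tendsto (m + 2) L ?F (\<lambda>x. 0)" "C_tendsto (m + 2) L ?R (\<lambda>x. 0)"
    "C_tendsto (m + 2) L ?K (\<lambda>x. 0)"
    using lim unfolding implicit_stage_def by simp_all
  have small: "\<forall>\<^sub>F \<epsilon> in at_right 0. 0 < \<epsilon> \<and> \<epsilon> < 1/2 \<and> 20 * \<bar>c\<bar> * \<epsilon>\<^sup>2 < 1"
  proof -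
    have "((\<lambda>\<epsilon>::real. 20 * \<bar>c\<bar> * \<epsilon>\<^sup>2) \<longlongrightarrow> 20 * \<bar>c\<bar> * 0) (at_right 0)"
      by (intro tendsto_intros tendsto_at_right_0_intros)
    then have "\<forall>\<^sub>F \<epsilon>::real in at_right 0. 20 * \<bar>c\<bar> * \<epsilon>\<^sup>2 < 1"
      by (rule order_tendstoD) simp
    moreover have "\<forall>\<^sub>F \<epsilon>::real in at_right 0. \<epsilon> < 1/2"
      by (rule order_tendstoD(2)[OF tendsto_at_right_0_intros(1)]) simp
    moreover have "\<forall>\<^sub>F \<epsilon>::real in at_right 0. 0 < \<epsilon>"
      by (rule eventually_at_right_less)
    ultimately show ?thesis by eventually_elim simp
  qed
  define D where "D = 1 + (1 + 10 * \<bar>c\<bar>) * (2 * (1 + 2 * \<bar>c\<bar> + c\<^sup>2)) / c\<^sup>2"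
  have "1 \<le> D" unfolding D_def by simp
  have "\<forall>\<^sub>F \<epsilon> in at_right 0. C_le m L e (?u \<epsilon>) \<and> C_le m L e (?v \<epsilon>) \<and> C_le m L e (?w \<epsilon>)"
    if "0 < e" for e
  proof -
    have "0 < e / D" using \<open>1 \<le> D\<close> that by simp
    note ev = rhs'[THEN C_tendsto_eventually, OF this]
    from ev stage small show ?thesis
    proof eventually_elim
      case (elim \<epsilon>)
      \<comment> \<open>As \<open>\<delta>1\<close> and \<open>\<delta>2\<close> are at most 1,
        \<open>\<epsilon> < 1/2\<close> keeps both coefficients above 1/2.\<close>
      have ab: "1/2 \<le> ?\<alpha> \<epsilon>" "?\<alpha> \<epsilon> \<le> 1" "1/2 \<le> ?\<beta> \<epsilon>" "?\<beta> \<epsilon> \<le> 1"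
        using elim(5) assms(3,4) mult_mono[of \<delta>1 1 \<epsilon> "1/2"] mult_mono[of \<delta>2 1 \<epsilon> "1/2"] by auto
      have r1: "periodic_C (Suc 0) L U" "periodic_C (Suc 0) L V" "periodic_C (Suc 0) L W"
        "periodic_C (Suc 0) L (u \<epsilon>)" "periodic_C (Suc 0) L (v \<epsilon>)" "periodic_C (Suc 0) L (w \<epsilon>)"
        using lim_reg elim(4) by (auto intro: periodic_C_mono)
      have st: "implicit_stage c \<epsilon> (?\<alpha> \<epsilon>) (?\<beta> \<epsilon>) \<gamma> (?u \<epsilon>) (?v \<epsilon>) (?w \<epsilon>) (?F \<epsilon>) (?R \<epsilon>) (?K \<epsilon>)"
        using elim(4) unfolding implicit_stage_def deriv_diff_fun[OF r1(4,1)]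
          deriv_diff_fun[OF r1(5,2)] deriv_diff_fun[OF r1(6,3)]
        by (auto simp: algebra_simps dest: spec)
      have "C_le m L (D * (e / D)) (?u \<epsilon>) \<and> C_le m L (D * (e / D)) (?v \<epsilon>) \<and> C_le m L (D * (e / D)) (?w \<epsilon>)"
        by (rule implicit_stage_C_bound[where c = c and \<alpha> = "?\<alpha> \<epsilon>" and \<beta> = "?\<beta> \<epsilon>" and \<gamma> = \<gamma>
              and F = "?F \<epsilon>" and R = "?R \<epsilon>" and K = "?K \<epsilon>" and \<epsilon> = \<epsilon>, folded D_def])
          (use elim ab st r1 assms(1-5) in \<open>auto intro: periodic_C_diff\<close>)
      then show ?case using \<open>1 \<le> D\<close> by simp
    qed
  qed
  then show ?thesis
    unfolding C_tendsto_def using lim_reg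
    by (auto simp: eventually_conj_iff intro: periodic_C_mono)
qed

section \<open>The explicit scheme for the BBM equation\<close>

lemma funpow_deriv_cmult:
  "periodic_C m L \<phi> \<Longrightarrow> k \<le> m \<Longrightarrow> (deriv ^^ k) (\<lambda>x. c * \<phi> x) = (\<lambda>x. c * (deriv ^^ k) \<phi> x)"
proof (induction k arbitrary: m \<phi>)
  case (Suc k)
  then obtain m' where m: "m = Suc m'" by (cases m) auto
  have "deriv (\<lambda>x. c * \<phi> x) = (\<lambda>x. c * deriv \<phi> x)"
    using Suc.prems periodic_C_field_differentiable[of m L \<phi>] by (auto simp: fun_eq_iff m)
  then show ?case
    using Suc.IH[of m' "deriv \<phi>"] Suc.prems unfolding funpow_deriv_Suc m
    by (simp add: periodic_C_Suc)
qed simp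

text \<open>Supplies the only information about \<open>v0\<close> that enters the first step besides
  its smoothness.\<close>

lemma admissible_v0_tendsto:
  assumes "admissible_v0 N L v0" "m \<le> N"
  shows "C_tendsto m L (\<lambda>\<epsilon> x. \<epsilon>\<^sup>2 * v0 \<epsilon> x) (\<lambda>x. 0)"
  unfolding C_tendsto_def
proof (intro conjI allI impI)
  fix e :: real assume "0 < e"
  have "\<forall>\<^sub>F \<epsilon> in at_right 0. \<forall>k\<in>{..m}. \<forall>x\<in>UNIV. dist (\<epsilon>\<^sup>2 * (deriv ^^ k) (v0 \<epsilon>) x) 0 < e"
    using assms \<open>0 < e\<close>
    by (intro eventually_ball_finite ballI uniform_limitD) (auto simp: admissible_v0_def)
  then show "\<forall>\<^sub>F \<epsilon> in at_right 0. C_le m L e (\<lambda>x. \<epsilon>\<^sup>2 * v0 \<epsilon> x - 0)"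
    using eventually_at_right_less[of "0 :: real"]
  proof eventually_elim
    case (elim \<epsilon>)
    have "periodic_C m L (v0 \<epsilon>)"
      using assms elim(2) by (auto simp: admissible_v0_def intro: periodic_C_mono)
    then have "periodic_C m L (\<lambda>x. \<epsilon>\<^sup>2 * v0 \<epsilon> x)"
      and "k \<le> m \<Longrightarrow> (deriv ^^ k) (\<lambda>x. \<epsilon>\<^sup>2 * v0 \<epsilon> x) = (\<lambda>x. \<epsilon>\<^sup>2 * (deriv ^^ k) (v0 \<epsilon>) x)" for k
      by (rule periodic_C_cmult, rule funpow_deriv_cmult)
    with elim(1) show ?case
      by (auto simp: C_le_def intro: less_imp_le)
  qed
qed (rule periodic_C_const)

section \<open>The Helmholtz operator: injectivity and regularity\<close>

lemma deriv2_diff: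
  assumes "periodic_C 2 L \<phi>" "periodic_C 2 L \<psi>"
  shows "deriv (deriv (\<lambda>x. \<phi> x - \<psi> x)) x = deriv (deriv \<phi>) x - deriv (deriv \<psi>) x"
proof -
  have "periodic_C (Suc 1) L \<phi>" "periodic_C (Suc 1) L \<psi>"
    "periodic_C (Suc 0) L (deriv \<phi>)" "periodic_C (Suc 0) L (deriv \<psi>)"
    using assms by (auto simp: numeral_2_eq_2 periodic_C_Suc)
  then show ?thesis by (simp add: deriv_diff_fun)
qed

lemma helmholtz_diff_quotient:
  assumes "periodic_C 2 L \<phi>" "periodic_C 2 L \<psi>"
  shows "helmholtz (\<lambda>x. (\<phi> x - \<psi> x) / c) x =
    (\<phi> x - \<psi> x) / c - (deriv (deriv \<phi>) x - deriv (deriv \<psi>) x) / c"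
proof -
  have "periodic_C 2 L (\<lambda>x. \<phi> x - \<psi> x)"
    using assms by (rule periodic_C_diff)
  from funpow_deriv_cmult[OF this, of 2 "1 / c"] show ?thesis
    by (simp add: helmholtz_def numeral_2_eq_2 deriv2_diff[OF assms] fun_eq_iff)
qed

text \<open>The second-order maximum principle with \<open>\<kappa> = \<mu> = 1\<close> and bound 0,
  applied to the difference.\<close>

lemma helmholtz_inject:
  assumes "0 < L" "periodic_C 2 L \<phi>" "periodic_C 2 L \<psi>" "\<And>x. helmholtz \<phi> x = helmholtz \<psi> x"
  shows "\<phi> x = \<psi> x"
proof -
  have "\<bar>\<phi> x - \<psi> x\<bar> \<le> 0 / 1"
    by (rule max_principle_second_order[OF assms(1), where \<phi> = "\<lambda>x. \<phi> x - \<psi> x" and \<mu> = 1])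
      (use assms periodic_C_diff[OF assms(2,3)] in \<open>simp_all add: helmholtz_def deriv2_diff algebra_simps\<close>)
  then show ?thesis by simp
qed

text \<open>Bootstrapping with \<open>deriv (deriv \<phi>) = \<phi> - r\<close>: each round raises
  the order of \<open>\<phi>\<close> by one until \<open>r\<close> limits it.\<close>

lemma helmholtz_regular:
  assumes "periodic_C 2 L \<phi>" "\<And>x. helmholtz \<phi> x = r x" "periodic_C m L r"
  shows "periodic_C (m + 2) L \<phi>"
  using assms(3)
proof (induction m)
  case 0
  show ?case using assms(1) by (simp add: numeral_2_eq_2)
next
  case (Suc m)
  then have "periodic_C (m + 2) L \<phi>"
    using periodic_C_mono[of "Suc m" L r m] by simp
  then have "periodic_C (Suc m) L \<phi>"
    by (rule periodic_C_mono) simp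
  then have "periodic_C (Suc m) L (\<lambda>x. \<phi> x - r x)"
    by (intro periodic_C_diff Suc.prems)
  moreover have "deriv (deriv \<phi>) x = \<phi> x - r x" for x
    using assms(2)[of x] by (simp add: helmholtz_def)
  moreover have "periodic_C (Suc 0) L (deriv \<phi>)"
    using assms(1) by (simp add: numeral_2_eq_2 periodic_C_Suc)
  ultimately have "periodic_C (Suc (Suc m)) L (deriv \<phi>)"
    using periodic_C_Suc_if_deriv[of 0 L "deriv \<phi>" "\<lambda>x. \<phi> x - r x"] by blast
  with assms(1) show ?case
    by (simp add: numeral_2_eq_2 periodic_C_Suc)
qed

text \<open>The nonlinearity costs one derivative and the inverse Helmholtz operator regains two, so
  the explicit scheme loses no smoothness; the order is limited only by
  \<open>\<eta>\<close>.\<close>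

lemma bbm_stage_regular:
  assumes "0 < \<tau>" "bbm_step M \<tau> \<eta> H \<eta>'" "periodic_C N L \<eta>" "2 \<le> N"
    and "\<And>i. i < stages M \<Longrightarrow> periodic_C 2 L (H i)" "i < stages M"
  shows "periodic_C N L (H i)"
  using assms(6)
proof (induction i rule: less_induct)
  case (less i)
  let ?z = "\<lambda>x. (H i x - \<eta> x) / \<tau>"
  let ?r = "\<lambda>x. - (\<Sum>j<i. expl_mat M $$ (i, j) * (H j x * deriv (H j) x))"
  obtain N' where N: "N = Suc N'" using assms(4) by (cases N) auto
  have H: "periodic_C (Suc N') L (H j)" if "j < i" for j
    using less that by (simp add: N)
  have \<eta>2: "periodic_C 2 L \<eta>" using assms(3,4) by (rule periodic_C_mono)
  have "periodic_C (N' + 2) L ?z"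
  proof (rule helmholtz_regular)
    show "periodic_C 2 L ?z"
      by (intro periodic_C_intros \<eta>2 assms(5) less.prems)
    show "helmholtz ?z x = ?r x" for x
      using assms(2) less.prems by (simp add: bbm_step_def)
    show "periodic_C N' L ?r"
      by (intro periodic_C_intros periodic_C_deriv H periodic_C_mono[OF H]) auto
  qed
  then have "periodic_C N L (\<lambda>x. \<eta> x + \<tau> * ?z x)"
    by (intro periodic_C_intros assms(3) periodic_C_mono[OF \<open>periodic_C (N' + 2) L ?z\<close>]) (simp add: N)
  then show ?case using \<open>0 < \<tau>\<close> by simp
qed

lemma lessThan_stages:
  assumes "dirk_imex M"
  shows "{..<stages M} = insert (stages M - 1) {..<stages M - 1}" "{..stages M - 1} = {..<stages M}"
  using assms by (auto simp: dirk_imex_def)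

text \<open>By GSA the update and the last stage have the same Helmholtz image; the extra summand of
  the update vanishes with the diagonal of the explicit matrix. Injectivity then identifies the two
  functions.\<close>

lemma bbm_step_GSA:
  assumes "dirk_imex M" "GSA M" "0 < L" "0 < \<tau>" "bbm_step M \<tau> \<eta> H \<eta>'"
    and reg: "periodic_C 2 L \<eta>" "periodic_C 2 L \<eta>'" "\<And>i. i < stages M \<Longrightarrow> periodic_C 2 L (H i)"
  shows "\<eta>' = H (stages M - 1)"
proof
  fix x
  let ?l = "stages M - 1"
  have l: "?l < stages M" using assms(1) by (simp add: dirk_imex_def)
  have "expl_mat M $$ (?l, ?l) = 0" and w: "\<And>i. i < stages M \<Longrightarrow> expl_wts M $ i = expl_mat M $$ (?l, i)"
    using assms(1,2) l by (simp_all add: dirk_imex_def GSA_def)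
  then have "(\<Sum>i<stages M. expl_wts M $ i * h i) = (\<Sum>j<?l. expl_mat M $$ (?l, j) * h j)" for h
    using w l by (simp add: lessThan_stages(1)[OF assms(1)])
  then have "helmholtz (\<lambda>x. (\<eta>' x - \<eta> x) / \<tau>) x = helmholtz (\<lambda>x. (H ?l x - \<eta> x) / \<tau>) x" for x
    using assms(5) l by (simp add: bbm_step_def)
  from helmholtz_inject[OF \<open>0 < L\<close> _ _ this]
  have "(\<eta>' x - \<eta> x) / \<tau> = (H ?l x - \<eta> x) / \<tau>"
    using reg l by (simp add: periodic_C_intros)
  then show "\<eta>' x = H ?l x" using \<open>0 < \<tau>\<close> by simp
qed

text \<open>No operator has to be inverted here: the formula of the update coincides with that of
  the last stage.\<close>

lemma imex_step_GSA:
  assumes "dirk_imex M" "GSA M" "imex_step M \<tau> f g q Q q'"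
  shows "q' = Q (stages M - 1)"
proof
  fix x
  let ?l = "stages M - 1"
  have l: "?l < stages M" using assms(1) by (simp add: dirk_imex_def)
  have "expl_mat M $$ (?l, ?l) = 0"
    and w: "\<And>i. i < stages M \<Longrightarrow> expl_wts M $ i = expl_mat M $$ (?l, i)"
      "\<And>i. i < stages M \<Longrightarrow> impl_wts M $ i = impl_mat M $$ (?l, i)"
    using assms(1,2) l by (simp_all add: dirk_imex_def GSA_def)
  then have "(\<Sum>i<stages M. (expl_wts M $ i) *\<^sub>R f (Q i) x) = (\<Sum>j<?l. (expl_mat M $$ (?l, j)) *\<^sub>R f (Q j) x)"
    using l by (simp add: lessThan_stages(1)[OF assms(1)])
  moreover have "(\<Sum>i<stages M. (impl_wts M $ i) *\<^sub>R g (Q i) x) = (\<Sum>j\<le>?l. (impl_mat M $$ (?l, j)) *\<^sub>R g (Q j) x)"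
    unfolding lessThan_stages(2)[OF assms(1)] using w by simp
  ultimately show "q' x = Q ?l x"
    using assms(3) l by (simp add: imex_step_def)
qed

section \<open>The implicit tableau\<close>

lemma impl_inv:
  assumes "dirk_imex M" "type_I M"
  shows "impl_inv M \<in> carrier_mat (stages M) (stages M)" "impl_mat M * impl_inv M = 1\<^sub>m (stages M)"
proof -
  let ?A = "impl_mat M" and ?n = "stages M"
  have A: "?A \<in> carrier_mat ?n ?n" using assms(1) by (simp add: dirk_imex_def)
  obtain B where B: "inverts_mat ?A B" "inverts_mat B ?A"
    using assms(2) by (auto simp: type_I_def invertible_mat_def)
  have "B \<in> carrier_mat ?n ?n"
    using B A unfolding inverts_mat_def
    by (metis carrier_matD carrier_matI index_mult_mat(2,3) index_one_mat(2,3))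
  \<comment> \<open>\<open>mat_inverse\<close> characterizes failure through the units of the matrix
    ring, so invertibility is restated in that form.\<close>
  with A B have "?A \<in> Units (ring_mat TYPE(real) ?n ())"
    by (auto simp: Units_def ring_mat_def inverts_mat_def)
  with mat_inverse(1)[OF A] obtain C where "mat_inverse ?A = Some C" by fastforce
  with mat_inverse(2)[OF A this]
  show "impl_inv M \<in> carrier_mat ?n ?n" "?A * impl_inv M = 1\<^sub>m ?n"
    by (simp_all add: impl_inv_def)
qed

text \<open>The determinant of a triangular matrix is the product of its diagonal, and invertibility
  makes it nonzero. This makes every single stage solvable for its own unknowns.\<close>

lemma impl_mat_diag_nonzero:
  assumes "dirk_imex M" "type_I M" "i < stages M"
  shows "impl_mat M $$ (i, i) \<noteq> 0"
proof -
  let ?A = "impl_mat M" and ?n = "stages M"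
  have A: "?A \<in> carrier_mat ?n ?n" using assms(1) by (simp add: dirk_imex_def)
  have "Determinant.det ?A * Determinant.det (impl_inv M) = 1"
    using Determinant.det_mult[OF A impl_inv(1)[OF assms(1,2)]] impl_inv(2)[OF assms(1,2)] by simp
  moreover have "Determinant.det ?A = prod_list (diag_mat ?A)"
    by (rule Determinant.det_lower_triangular[OF _ A]) (use assms(1) in \<open>auto simp: dirk_imex_def\<close>)
  ultimately have "(\<Prod>i<?n. ?A $$ (i, i)) \<noteq> 0"
    using A by (auto simp: prod_list_diag_prod atLeast0LessThan simp del: prod_zero_iff)
  then show ?thesis
    using assms(3) by (simp add: prod_zero_iff)
qed

text \<open>Row \<open>i\<close> of the identity A A^(-1) y = y, with the outer sum cut off at the
  diagonal as in the stage equations.\<close>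

lemma impl_mat_impl_inv_sum:
  assumes "dirk_imex M" "type_I M" "i < stages M"
  shows "(\<Sum>j\<le>i. impl_mat M $$ (i, j) * (\<Sum>k<stages M. impl_inv M $$ (j, k) * y k)) = y i"
proof -
  let ?A = "impl_mat M" and ?B = "impl_inv M" and ?n = "stages M"
  have A: "?A \<in> carrier_mat ?n ?n" using assms(1) by (simp add: dirk_imex_def)
  note B = impl_inv[OF assms(1,2)]
  have AB: "(\<Sum>j<?n. ?A $$ (i, j) * ?B $$ (j, k)) = (if i = k then 1 else 0)" if "k < ?n" for k
  proof -
    have "(?A * ?B) $$ (i, k) = (\<Sum>j<?n. ?A $$ (i, j) * ?B $$ (j, k))"
      using A B(1) assms(3) that by (auto simp: scalar_prod_def atLeast0LessThan)
    with B(2) assms(3) that show ?thesis by simp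
  qed
  have "(\<Sum>j\<le>i. ?A $$ (i, j) * (\<Sum>k<?n. ?B $$ (j, k) * y k)) =
      (\<Sum>j<?n. ?A $$ (i, j) * (\<Sum>k<?n. ?B $$ (j, k) * y k))"
    by (rule sum.mono_neutral_left) (use assms in \<open>auto simp: dirk_imex_def\<close>)
  also have "\<dots> = (\<Sum>j<?n. \<Sum>k<?n. ?A $$ (i, j) * ?B $$ (j, k) * y k)"
    by (simp add: sum_distrib_left mult.assoc)
  also have "\<dots> = (\<Sum>k<?n. \<Sum>j<?n. ?A $$ (i, j) * ?B $$ (j, k) * y k)"
    by (rule sum.swap)
  also have "\<dots> = (\<Sum>k<?n. (\<Sum>j<?n. ?A $$ (i, j) * ?B $$ (j, k)) * y k)"
    by (simp only: sum_distrib_right)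
  also have "\<dots> = (\<Sum>k<?n. if i = k then y k else 0)"
    by (rule sum.cong) (auto simp: AB)
  also have "\<dots> = y i" using assms(3) by simp
  finally show ?thesis .
qed

section \<open>Convergence of stages and steps\<close>

text \<open>
  The limits of the stage values of \<open>v\<close>, obtained by solving
  \<open>H\<^sub>x - \<eta>\<^sub>x = - \<tau> A V\<close> for \<open>V\<close>.
\<close>

definition bbm_v ::
  "imex \<Rightarrow> real \<Rightarrow> (real \<Rightarrow> real) \<Rightarrow> (nat \<Rightarrow> real \<Rightarrow> real) \<Rightarrow> nat \<Rightarrow> real \<Rightarrow> real" where
  "bbm_v M \<tau> \<eta> H i x = - (\<Sum>k<stages M. impl_inv M $$ (i, k) * ((deriv (H k) x - deriv \<eta> x) / \<tau>))"

text \<open>The discrete time derivative uses the last row of the inverse, the row that defines the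
  limit of \<open>v\<close> in the last stage.\<close>

lemma bbm_v_last: "bbm_v M \<tau> \<eta> H (stages M - 1) x = - discrete_dt M \<tau> (deriv \<eta>) (\<lambda>j. deriv (H j)) x"
  by (simp add: bbm_v_def discrete_dt_def)

lemma periodic_C_bbm_v:
  assumes "periodic_C (Suc m) L \<eta>" "\<And>k. k < stages M \<Longrightarrow> periodic_C (Suc m) L (H k)"
  shows "periodic_C m L (bbm_v M \<tau> \<eta> H i)"
proof -
  have "periodic_C m L (\<lambda>x. - (\<Sum>k<stages M. impl_inv M $$ (i, k) * ((deriv (H k) x - deriv \<eta> x) / \<tau>)))"
    using assms by (intro periodic_C_intros periodic_C_deriv) auto
  then show ?thesis by (simp add: bbm_v_def[abs_def])
qed

lemma deriv_bbm_v:
  assumes "periodic_C 2 L \<eta>" "\<And>k. k < stages M \<Longrightarrow> periodic_C 2 L (H k)"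
  shows "deriv (bbm_v M \<tau> \<eta> H i) x =
    - (\<Sum>k<stages M. impl_inv M $$ (i, k) * ((deriv (deriv (H k)) x - deriv (deriv \<eta>) x) / \<tau>))"
proof -
  have D: "(deriv \<phi> has_real_derivative deriv (deriv \<phi>) x) (at x)" if "periodic_C 2 L \<phi>" for \<phi>
    using that by (intro periodic_C_has_deriv[of 1 L] periodic_C_deriv) (simp_all add: numeral_2_eq_2)
  show ?thesis
    unfolding bbm_v_def[abs_def]
    by (rule DERIV_imp_deriv) (auto intro!: DERIV_minus DERIV_sum DERIV_cmult DERIV_cdivide DERIV_diff D assms)
qed

text \<open>By the choice of \<open>V\<close>, the implicit sum of the \<open>deriv (V j)\<close>
  yields the second-derivative part of the Helmholtz operator, so the first equation is the BBM
  stage equation. The second one reads \<open>deriv (H i) - deriv (H i) = 0\<close>, and the third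
  is the definition of \<open>V\<close>.\<close>

lemma implicit_stage_bbm:
  assumes "dirk_imex M" "type_I M" "0 < \<tau>" "bbm_step M \<tau> \<eta> H \<eta>'" "i < stages M"
    and reg: "periodic_C 2 L \<eta>" "\<And>k. k < stages M \<Longrightarrow> periodic_C 2 L (H k)"
  shows "implicit_stage (\<tau> * impl_mat M $$ (i, i)) 0 1 1 \<gamma> (H i) (bbm_v M \<tau> \<eta> H i) (deriv (H i))
    (\<lambda>x. \<eta> x - \<tau> * (\<Sum>j<i. expl_mat M $$ (i, j) * (H j x * deriv (H j) x))
             - \<tau> * (\<Sum>j<i. impl_mat M $$ (i, j) * deriv (bbm_v M \<tau> \<eta> H j) x))
    (\<lambda>x. 0)
    (\<lambda>x. deriv \<eta> x - \<tau> * (\<Sum>j<i. impl_mat M $$ (i, j) * bbm_v M \<tau> \<eta> H j x))"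
proof -
  let ?V = "bbm_v M \<tau> \<eta> H"
  have split: "(\<Sum>j\<le>i. h j) = (\<Sum>j<i. h j) + h i" for h :: "nat \<Rightarrow> real"
    by (simp flip: lessThan_Suc_atMost)
  have V: "(\<Sum>j<i. impl_mat M $$ (i, j) * ?V j x) + impl_mat M $$ (i, i) * ?V i x =
      - ((deriv (H i) x - deriv \<eta> x) / \<tau>)" for x
    using impl_mat_impl_inv_sum[OF assms(1,2,5), of "\<lambda>k. (deriv (H k) x - deriv \<eta> x) / \<tau>"]
    unfolding split by (simp add: bbm_v_def sum_negf)
  have V': "(\<Sum>j<i. impl_mat M $$ (i, j) * deriv (?V j) x) + impl_mat M $$ (i, i) * deriv (?V i) x =
      - ((deriv (deriv (H i)) x - deriv (deriv \<eta>) x) / \<tau>)" for x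
    using impl_mat_impl_inv_sum[OF assms(1,2,5), of "\<lambda>k. (deriv (deriv (H k)) x - deriv (deriv \<eta>) x) / \<tau>"]
    unfolding split by (simp add: deriv_bbm_v[OF reg] sum_negf)
  have U: "(H i x - \<eta> x) / \<tau> - (deriv (deriv (H i)) x - deriv (deriv \<eta>) x) / \<tau> =
      - (\<Sum>j<i. expl_mat M $$ (i, j) * (H j x * deriv (H j) x))" for x
    using assms(4,5) helmholtz_diff_quotient[OF reg(2)[OF assms(5)] reg(1), of \<tau> x]
    by (simp add: bbm_step_def)
  \<comment> \<open>With \<open>s\<close> the sum over earlier stages, this isolates the diagonal
    term from the full row sums \<open>V\<close> and \<open>V'\<close>.\<close>
  have aux: "\<tau> * a * b = \<tau> * (s + a * b) - \<tau> * s" for a b s :: real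
    by (simp add: algebra_simps)
  show ?thesis
    unfolding implicit_stage_def
  proof (intro conjI allI)
    fix x
    have "\<tau> * impl_mat M $$ (i, i) * deriv (?V i) x =
        - (deriv (deriv (H i)) x - deriv (deriv \<eta>) x) - \<tau> * (\<Sum>j<i. impl_mat M $$ (i, j) * deriv (?V j) x)"
      using V'[of x] \<open>0 < \<tau>\<close>
      by (subst aux[where s = "\<Sum>j<i. impl_mat M $$ (i, j) * deriv (?V j) x"]) simp
    moreover have "H i x - \<eta> x - (deriv (deriv (H i)) x - deriv (deriv \<eta>) x) =
        - \<tau> * (\<Sum>j<i. expl_mat M $$ (i, j) * (H j x * deriv (H j) x))"
      using U[of x] \<open>0 < \<tau>\<close> unfolding diff_divide_distrib[symmetric]
      by (simp add: nonzero_divide_eq_eq mult.commute)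
    ultimately show "H i x + \<tau> * impl_mat M $$ (i, i) * (1 * deriv (?V i) x) =
        \<eta> x - \<tau> * (\<Sum>j<i. expl_mat M $$ (i, j) * (H j x * deriv (H j) x))
             - \<tau> * (\<Sum>j<i. impl_mat M $$ (i, j) * deriv (?V j) x)"
      by simp
    show "deriv (H i) x + \<tau> * impl_mat M $$ (i, i) * (\<gamma> * 0\<^sup>2 * deriv (deriv (H i)) x + ?V i x) =
        deriv \<eta> x - \<tau> * (\<Sum>j<i. impl_mat M $$ (i, j) * ?V j x)"
    proof -
      have "\<tau> * impl_mat M $$ (i, i) * ?V i x =
          - (deriv (H i) x - deriv \<eta> x) - \<tau> * (\<Sum>j<i. impl_mat M $$ (i, j) * ?V j x)"
        using V[of x] \<open>0 < \<tau>\<close>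
        by (subst aux[where s = "\<Sum>j<i. impl_mat M $$ (i, j) * ?V j x"]) simp
      then show ?thesis by simp
    qed
  qed simp
qed

text \<open>Moves the diagonal implicit term to the left and multiplies the \<open>v\<close>
  equation by \<open>\<epsilon>\<^sup>2\<close>. The explicit coefficient
  \<open>\<delta>2 / \<epsilon>\<close> becomes \<open>\<delta>2 * \<epsilon>\<close>, so no
  negative power of \<open>\<epsilon>\<close> remains in the data.\<close>

lemma implicit_stage_bbmh:
  assumes "0 < \<epsilon>" "i < stages M"
    and "imex_step M \<tau> (bbmh_f \<delta>1 \<delta>2 \<delta>3 \<epsilon>) (bbmh_g \<delta>1 \<delta>2 \<delta>3 \<epsilon>) q Q q'"
  shows "implicit_stage (\<tau> * impl_mat M $$ (i, i)) \<epsilon> (1 - \<delta>1 * \<epsilon>) (1 - \<delta>2 * \<epsilon>) (1 - \<delta>3)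
    (u_of (Q i)) (v_of (Q i)) (w_of (Q i))
    (\<lambda>x. u_of q x
       - \<tau> * (\<Sum>j<i. expl_mat M $$ (i, j) * (u_of (Q j) x * deriv (u_of (Q j)) x + \<delta>1 * (\<epsilon> * deriv (v_of (Q j)) x)))
       - \<tau> * (\<Sum>j<i. impl_mat M $$ (i, j) * ((1 - \<delta>1 * \<epsilon>) * deriv (v_of (Q j)) x)))
    (\<lambda>x. \<epsilon>\<^sup>2 * v_of q x
       - \<tau> * (\<Sum>j<i. expl_mat M $$ (i, j) * (\<delta>2 * (\<epsilon> * deriv (u_of (Q j)) x)))
       - \<tau> * (\<Sum>j<i. impl_mat M $$ (i, j) * ((1 - \<delta>2 * \<epsilon>) * deriv (u_of (Q j)) x - w_of (Q j) x)))
    (\<lambda>x. w_of q x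
       - \<tau> * (\<Sum>j<i. expl_mat M $$ (i, j) * (\<delta>3 * (\<epsilon>\<^sup>2 * deriv (w_of (Q j)) x)))
       - \<tau> * (\<Sum>j<i. impl_mat M $$ (i, j) * ((1 - \<delta>3) * (\<epsilon>\<^sup>2 * deriv (w_of (Q j)) x) + v_of (Q j) x)))"
proof -
  let ?A = "impl_mat M" and ?E = "expl_mat M"
  have split: "(\<Sum>j\<le>i. h j) = (\<Sum>j<i. h j) + h i" for h :: "nat \<Rightarrow> real"
    by (simp flip: lessThan_Suc_atMost)
  have step: "Q i x = q x + \<tau> *\<^sub>R (\<Sum>j<i. (?E $$ (i, j)) *\<^sub>R bbmh_f \<delta>1 \<delta>2 \<delta>3 \<epsilon> (Q j) x)
      + \<tau> *\<^sub>R (\<Sum>j\<le>i. (?A $$ (i, j)) *\<^sub>R bbmh_g \<delta>1 \<delta>2 \<delta>3 \<epsilon> (Q j) x)" for x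
    using assms(2,3) by (simp add: imex_step_def)
  have u: "u_of (Q i) x = u_of q x
      - \<tau> * (\<Sum>j<i. ?E $$ (i, j) * (u_of (Q j) x * deriv (u_of (Q j)) x + \<delta>1 * (\<epsilon> * deriv (v_of (Q j)) x)))
      - \<tau> * (\<Sum>j\<le>i. ?A $$ (i, j) * ((1 - \<delta>1 * \<epsilon>) * deriv (v_of (Q j)) x))" for x
    using arg_cong[OF step[of x], of fst]
    by (simp add: fst_sum bbmh_f_def bbmh_g_def sum_negf mult.assoc del: minus_add_distrib)
  have w: "w_of (Q i) x = w_of q x
      - \<tau> * (\<Sum>j<i. ?E $$ (i, j) * (\<delta>3 * (\<epsilon>\<^sup>2 * deriv (w_of (Q j)) x)))
      - \<tau> * (\<Sum>j\<le>i. ?A $$ (i, j) * ((1 - \<delta>3) * (\<epsilon>\<^sup>2 * deriv (w_of (Q j)) x) + v_of (Q j) x))" for x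
    using arg_cong[OF step[of x], of "\<lambda>p. snd (snd p)"]
    by (simp add: snd_sum bbmh_f_def bbmh_g_def sum_negf mult.assoc del: minus_add_distrib)
  have scale: "a = b - \<tau> * s - \<tau> * t \<Longrightarrow> e * a = e * b - \<tau> * (e * s) - \<tau> * (e * t)"
    for a b s t e :: real
    by (simp add: right_diff_distrib mult.left_commute)
  have v: "\<epsilon>\<^sup>2 * v_of (Q i) x = \<epsilon>\<^sup>2 * v_of q x
      - \<tau> * (\<Sum>j<i. ?E $$ (i, j) * (\<delta>2 * (\<epsilon> * deriv (u_of (Q j)) x)))
      - \<tau> * (\<Sum>j\<le>i. ?A $$ (i, j) * ((1 - \<delta>2 * \<epsilon>) * deriv (u_of (Q j)) x - w_of (Q j) x))" for x
  proof -
    have "v_of (Q i) x = v_of q x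
        - \<tau> * (\<Sum>j<i. ?E $$ (i, j) * (\<delta>2 / \<epsilon> * deriv (u_of (Q j)) x))
        - \<tau> * (\<Sum>j\<le>i. ?A $$ (i, j) * ((1 - \<delta>2 * \<epsilon>) / \<epsilon>\<^sup>2 * deriv (u_of (Q j)) x - 1 / \<epsilon>\<^sup>2 * w_of (Q j) x))"
      using arg_cong[OF step[of x], of "\<lambda>p. fst (snd p)"]
      by (simp add: fst_sum snd_sum bbmh_f_def bbmh_g_def sum_negf del: minus_add_distrib minus_diff_eq)
    then have "\<epsilon>\<^sup>2 * v_of (Q i) x = \<epsilon>\<^sup>2 * v_of q x
        - \<tau> * (\<Sum>j<i. \<epsilon>\<^sup>2 * (?E $$ (i, j) * (\<delta>2 / \<epsilon> * deriv (u_of (Q j)) x)))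
        - \<tau> * (\<Sum>j\<le>i. \<epsilon>\<^sup>2 * (?A $$ (i, j) * ((1 - \<delta>2 * \<epsilon>) / \<epsilon>\<^sup>2 * deriv (u_of (Q j)) x - 1 / \<epsilon>\<^sup>2 * w_of (Q j) x)))"
      unfolding sum_distrib_left[symmetric]
      by (rule scale)
    moreover have "\<epsilon>\<^sup>2 * (?E $$ (i, j) * (\<delta>2 / \<epsilon> * deriv (u_of (Q j)) x)) =
        ?E $$ (i, j) * (\<delta>2 * (\<epsilon> * deriv (u_of (Q j)) x))" for j
      using \<open>0 < \<epsilon>\<close> by (simp add: field_simps power2_eq_square)
    moreover have "\<epsilon>\<^sup>2 * (?A $$ (i, j) * ((1 - \<delta>2 * \<epsilon>) / \<epsilon>\<^sup>2 * deriv (u_of (Q j)) x - 1 / \<epsilon>\<^sup>2 * w_of (Q j) x)) =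
        ?A $$ (i, j) * ((1 - \<delta>2 * \<epsilon>) * deriv (u_of (Q j)) x - w_of (Q j) x)" for j
      using \<open>0 < \<epsilon>\<close> by (simp add: field_simps)
    ultimately show ?thesis by (simp only:)
  qed
  show ?thesis
    unfolding implicit_stage_def
  proof (intro conjI allI)
    fix x
    show "u_of (Q i) x + \<tau> * ?A $$ (i, i) * ((1 - \<delta>1 * \<epsilon>) * deriv (v_of (Q i)) x) = u_of q x
       - \<tau> * (\<Sum>j<i. ?E $$ (i, j) * (u_of (Q j) x * deriv (u_of (Q j)) x + \<delta>1 * (\<epsilon> * deriv (v_of (Q j)) x)))
       - \<tau> * (\<Sum>j<i. ?A $$ (i, j) * ((1 - \<delta>1 * \<epsilon>) * deriv (v_of (Q j)) x))"
      using u[of x] unfolding split distrib_left[of \<tau>] by (simp add: mult.assoc)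
    show "\<epsilon>\<^sup>2 * v_of (Q i) x + \<tau> * ?A $$ (i, i) * ((1 - \<delta>2 * \<epsilon>) * deriv (u_of (Q i)) x - w_of (Q i) x) =
       \<epsilon>\<^sup>2 * v_of q x
       - \<tau> * (\<Sum>j<i. ?E $$ (i, j) * (\<delta>2 * (\<epsilon> * deriv (u_of (Q j)) x)))
       - \<tau> * (\<Sum>j<i. ?A $$ (i, j) * ((1 - \<delta>2 * \<epsilon>) * deriv (u_of (Q j)) x - w_of (Q j) x))"
      using v[of x] unfolding split distrib_left[of \<tau>] by (simp add: mult.assoc)
    show "w_of (Q i) x + \<tau> * ?A $$ (i, i) * ((1 - \<delta>3) * \<epsilon>\<^sup>2 * deriv (w_of (Q i)) x + v_of (Q i) x) = w_of q x
       - \<tau> * (\<Sum>j<i. ?E $$ (i, j) * (\<delta>3 * (\<epsilon>\<^sup>2 * deriv (w_of (Q j)) x)))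
       - \<tau> * (\<Sum>j<i. ?A $$ (i, j) * ((1 - \<delta>3) * (\<epsilon>\<^sup>2 * deriv (w_of (Q j)) x) + v_of (Q j) x))"
      using w[of x] unfolding split distrib_left[of \<tau>] by (simp add: mult.assoc)
  qed
qed

text \<open>Strong induction over the stages, with an order of convergence that falls by 3 per stage
  and reaches \<open>m\<close> at the last one.\<close>

lemma bbmh_stage_tendsto:
  assumes M: "dirk_imex M" "type_I M"
    and par: "\<delta>1 \<in> {0..1}" "\<delta>2 \<in> {0..1}" "\<delta>3 \<in> {0..1}" "0 < \<tau>" "0 < L"
    and bbm: "bbm_step M \<tau> \<eta> H \<eta>'"
    and reg: "periodic_C (m + 3 * stages M + 4) L \<eta>"
      "\<And>k. k < stages M \<Longrightarrow> periodic_C (m + 3 * stages M + 4) L (H k)"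
    and bbmh: "\<forall>\<^sub>F \<epsilon> in at_right 0. (\<forall>i<stages M. bbmh_state L (Q \<epsilon> i)) \<and>
      imex_step M \<tau> (bbmh_f \<delta>1 \<delta>2 \<delta>3 \<epsilon>) (bbmh_g \<delta>1 \<delta>2 \<delta>3 \<epsilon>) (q \<epsilon>) (Q \<epsilon>) (q' \<epsilon>)"
    and init: "C_tendsto (m + 3 * stages M) L (\<lambda>\<epsilon>. u_of (q \<epsilon>)) \<eta>"
      "C_tendsto (m + 3 * stages M) L (\<lambda>\<epsilon> x. \<epsilon>\<^sup>2 * v_of (q \<epsilon>) x) (\<lambda>x. 0)"
      "C_tendsto (m + 3 * stages M) L (\<lambda>\<epsilon>. w_of (q \<epsilon>)) (deriv \<eta>)"
    and "i < stages M"
  shows "C_tendsto (m + 3 * (stages M - 1 - i)) L (\<lambda>\<epsilon>. u_of (Q \<epsilon> i)) (H i) \<and>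
    C_tendsto (m + 3 * (stages M - 1 - i)) L (\<lambda>\<epsilon>. v_of (Q \<epsilon> i)) (bbm_v M \<tau> \<eta> H i) \<and>
    C_tendsto (m + 3 * (stages M - 1 - i)) L (\<lambda>\<epsilon>. w_of (Q \<epsilon> i)) (deriv (H i))"
  using \<open>i < stages M\<close>
proof (induction i rule: less_induct)
  case (less i)
  let ?V = "bbm_v M \<tau> \<eta> H" and ?A = "impl_mat M" and ?E = "expl_mat M"
  define k where "k = m + 3 * (stages M - 1 - i)"
  have IH: "C_tendsto (k + 3) L (\<lambda>\<epsilon>. u_of (Q \<epsilon> j)) (H j)"
    "C_tendsto (k + 3) L (\<lambda>\<epsilon>. v_of (Q \<epsilon> j)) (?V j)"
    "C_tendsto (k + 3) L (\<lambda>\<epsilon>. w_of (Q \<epsilon> j)) (deriv (H j))" if "j < i" for j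
  proof -
    \<comment> \<open>Earlier stages are known to order \<open>k + 3\<close>: one derivative goes
      into the data, and the stage estimate consumes the other two.\<close>
    have "k + 3 \<le> m + 3 * (stages M - 1 - j)"
      using that less.prems by (simp add: k_def)
    with less.IH[OF that] that less.prems show "C_tendsto (k + 3) L (\<lambda>\<epsilon>. u_of (Q \<epsilon> j)) (H j)"
      "C_tendsto (k + 3) L (\<lambda>\<epsilon>. v_of (Q \<epsilon> j)) (?V j)"
      "C_tendsto (k + 3) L (\<lambda>\<epsilon>. w_of (Q \<epsilon> j)) (deriv (H j))"
      by (auto intro: C_tendsto_mono)
  qed
  have IH': "C_tendsto (k + 2) L (\<lambda>\<epsilon>. u_of (Q \<epsilon> j)) (H j)"
    "C_tendsto (k + 2) L (\<lambda>\<epsilon>. v_of (Q \<epsilon> j)) (?V j)"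
    "C_tendsto (k + 2) L (\<lambda>\<epsilon>. w_of (Q \<epsilon> j)) (deriv (H j))"
    "C_tendsto (k + 2) L (\<lambda>\<epsilon>. deriv (u_of (Q \<epsilon> j))) (deriv (H j))"
    "C_tendsto (k + 2) L (\<lambda>\<epsilon>. deriv (v_of (Q \<epsilon> j))) (deriv (?V j))"
    "C_tendsto (k + 2) L (\<lambda>\<epsilon>. deriv (w_of (Q \<epsilon> j))) (deriv (deriv (H j)))" if "j < i" for j
    using IH[OF that]
    by (auto intro: C_tendsto_mono C_tendsto_deriv simp: numeral_2_eq_2 numeral_3_eq_3)
  have k: "k + 3 \<le> m + 3 * stages M"
    using less.prems by (simp add: k_def)
  have init': "C_tendsto (k + 2) L (\<lambda>\<epsilon>. u_of (q \<epsilon>)) \<eta>"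
    "C_tendsto (k + 2) L (\<lambda>\<epsilon> x. \<epsilon>\<^sup>2 * v_of (q \<epsilon>) x) (\<lambda>x. 0)"
    "C_tendsto (k + 2) L (\<lambda>\<epsilon>. w_of (q \<epsilon>)) (deriv \<eta>)"
    using k by (auto intro: C_tendsto_mono[OF init(1)] C_tendsto_mono[OF init(2)] C_tendsto_mono[OF init(3)])
  \<comment> \<open>Order \<open>k + 4\<close>, because \<open>V\<close> must be of order
    \<open>k + 3\<close> and contains first derivatives of \<open>\<eta>\<close> and
    \<open>H\<close>.\<close>
  have reg': "periodic_C (Suc (k + 3)) L \<eta>" "\<And>l. l < stages M \<Longrightarrow> periodic_C (Suc (k + 3)) L (H l)"
    using k by (auto intro!: periodic_C_mono[OF reg(1)] periodic_C_mono[OF reg(2)])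
  have reg2: "periodic_C 2 L \<eta>" "\<And>l. l < stages M \<Longrightarrow> periodic_C 2 L (H l)"
    by (auto intro!: periodic_C_mono[OF reg'(1)] periodic_C_mono[OF reg'(2)])
  note intros = C_tendsto_sum C_tendsto_diff C_tendsto_add C_tendsto_mult C_tendsto_scalar
    C_tendsto_const[OF periodic_C_const] tendsto_at_right_0_intros \<open>0 < L\<close> IH' init'
  let ?F = "\<lambda>\<epsilon> x. u_of (q \<epsilon>) x
       - \<tau> * (\<Sum>j<i. ?E $$ (i, j) * (u_of (Q \<epsilon> j) x * deriv (u_of (Q \<epsilon> j)) x + \<delta>1 * (\<epsilon> * deriv (v_of (Q \<epsilon> j)) x)))
       - \<tau> * (\<Sum>j<i. ?A $$ (i, j) * ((1 - \<delta>1 * \<epsilon>) * deriv (v_of (Q \<epsilon> j)) x))"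
  let ?R = "\<lambda>\<epsilon> x. \<epsilon>\<^sup>2 * v_of (q \<epsilon>) x
       - \<tau> * (\<Sum>j<i. ?E $$ (i, j) * (\<delta>2 * (\<epsilon> * deriv (u_of (Q \<epsilon> j)) x)))
       - \<tau> * (\<Sum>j<i. ?A $$ (i, j) * ((1 - \<delta>2 * \<epsilon>) * deriv (u_of (Q \<epsilon> j)) x - w_of (Q \<epsilon> j) x))"
  let ?K = "\<lambda>\<epsilon> x. w_of (q \<epsilon>) x
       - \<tau> * (\<Sum>j<i. ?E $$ (i, j) * (\<delta>3 * (\<epsilon>\<^sup>2 * deriv (w_of (Q \<epsilon> j)) x)))
       - \<tau> * (\<Sum>j<i. ?A $$ (i, j) * ((1 - \<delta>3) * (\<epsilon>\<^sup>2 * deriv (w_of (Q \<epsilon> j)) x) + v_of (Q \<epsilon> j) x))"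
  have "C_tendsto (k + 2) L ?F (\<lambda>x. \<eta> x
       - \<tau> * (\<Sum>j<i. ?E $$ (i, j) * (H j x * deriv (H j) x + \<delta>1 * (0 * deriv (?V j) x)))
       - \<tau> * (\<Sum>j<i. ?A $$ (i, j) * (1 * deriv (?V j) x)))"
    by (intro intros) simp_all
  \<comment> \<open>The explicit part vanishes with \<open>\<epsilon>\<close>, and the implicit part
    because in the limit \<open>w\<close> is the derivative of \<open>u\<close> at all earlier
    stages.\<close>
  moreover have "C_tendsto (k + 2) L ?R (\<lambda>x. 0
       - \<tau> * (\<Sum>j<i. ?E $$ (i, j) * (\<delta>2 * (0 * deriv (H j) x)))
       - \<tau> * (\<Sum>j<i. ?A $$ (i, j) * (1 * deriv (H j) x - deriv (H j) x)))"
    by (intro intros) simp_all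
  moreover have "C_tendsto (k + 2) L ?K (\<lambda>x. deriv \<eta> x
       - \<tau> * (\<Sum>j<i. ?E $$ (i, j) * (\<delta>3 * (0 * deriv (deriv (H j)) x)))
       - \<tau> * (\<Sum>j<i. ?A $$ (i, j) * ((1 - \<delta>3) * (0 * deriv (deriv (H j)) x) + ?V j x)))"
    by (intro intros) simp_all
  ultimately have rhs: "C_tendsto (k + 2) L ?F (\<lambda>x. \<eta> x
       - \<tau> * (\<Sum>j<i. ?E $$ (i, j) * (H j x * deriv (H j) x))
       - \<tau> * (\<Sum>j<i. ?A $$ (i, j) * deriv (?V j) x))"
    "C_tendsto (k + 2) L ?R (\<lambda>x. 0)"
    "C_tendsto (k + 2) L ?K (\<lambda>x. deriv \<eta> x - \<tau> * (\<Sum>j<i. ?A $$ (i, j) * ?V j x))"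
    by simp_all
  have "\<tau> * ?A $$ (i, i) \<noteq> 0"
    using impl_mat_diag_nonzero[OF M less.prems] \<open>0 < \<tau>\<close> by simp
  moreover have "\<forall>\<^sub>F \<epsilon> in at_right 0.
      periodic_C 1 L (u_of (Q \<epsilon> i)) \<and> periodic_C 1 L (v_of (Q \<epsilon> i)) \<and> periodic_C 1 L (w_of (Q \<epsilon> i)) \<and>
      implicit_stage (\<tau> * ?A $$ (i, i)) \<epsilon> (1 - \<delta>1 * \<epsilon>) (1 - \<delta>2 * \<epsilon>) (1 - \<delta>3)
        (u_of (Q \<epsilon> i)) (v_of (Q \<epsilon> i)) (w_of (Q \<epsilon> i)) (?F \<epsilon>) (?R \<epsilon>) (?K \<epsilon>)"
    using bbmh eventually_at_right_less[of "0 :: real"]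
  proof eventually_elim
    case (elim \<epsilon>)
    then have "bbmh_state L (Q \<epsilon> i)" using less.prems by blast
    with implicit_stage_bbmh[OF elim(2) less.prems conjunct2[OF elim(1)]] show ?case
      by (simp add: bbmh_state_def)
  qed
  moreover have "periodic_C (k + 3) L (H i)" "periodic_C (k + 3) L (deriv (H i))"
    using reg'(2)[OF less.prems] by (auto intro: periodic_C_mono periodic_C_deriv)
  moreover have "periodic_C (k + 3) L (?V i)"
    using reg' by (rule periodic_C_bbm_v)
  moreover have "1 - \<delta>3 \<in> {0..1}" using par(3) by simp
  moreover note implicit_stage_bbm[OF M \<open>0 < \<tau>\<close> bbm less.prems reg2, of "1 - \<delta>3"]
  ultimately show ?case
    unfolding k_def[symmetric] by (intro implicit_stage_tendsto[OF \<open>0 < L\<close> _ par(1,2) _ _ rhs])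
qed

text \<open>The invariant carries \<open>\<epsilon>\<^sup>2 * v\<close> at every level, since
  \<open>v\<close> itself need not converge at \<open>k = 0\<close>; convergence of \<open>v\<close>
  is an output of each step, stated for \<open>1 \<le> k\<close>. The order falls by
  \<open>3 * stages M\<close> per step.\<close>

lemma bbmh_steps_tendsto:
  assumes M: "dirk_imex M" "type_I M" "GSA M"
    and par: "\<delta>1 \<in> {0..1}" "\<delta>2 \<in> {0..1}" "\<delta>3 \<in> {0..1}" "0 < \<tau>" "0 < L"
    and N: "N = 3 * stages M * n + 4"
    and init: "periodic_C N L \<eta>0" "admissible_v0 N L v0"
    and bbmh: "\<forall>\<^sub>F \<epsilon> in at_right 0. bbmh_numerical_solution M \<delta>1 \<delta>2 \<delta>3 \<epsilon> L \<tau> n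
           (\<lambda>x. (\<eta>0 x, v0 \<epsilon> x, deriv \<eta>0 x)) (q \<epsilon>) (Q \<epsilon>)"
    and bbm: "bbm_numerical_solution M L \<tau> n \<eta>0 \<eta> H"
    and "k \<le> n"
  shows "periodic_C N L (\<eta> k) \<and>
    C_tendsto (3 * stages M * (n - k)) L (\<lambda>\<epsilon>. u_of (q \<epsilon> k)) (\<eta> k) \<and>
    C_tendsto (3 * stages M * (n - k)) L (\<lambda>\<epsilon> x. \<epsilon>\<^sup>2 * v_of (q \<epsilon> k) x) (\<lambda>x. 0) \<and>
    C_tendsto (3 * stages M * (n - k)) L (\<lambda>\<epsilon>. w_of (q \<epsilon> k)) (deriv (\<eta> k)) \<and>
    (1 \<le> k \<longrightarrow> C_tendsto (3 * stages M * (n - k)) L (\<lambda>\<epsilon>. v_of (q \<epsilon> k))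
       (\<lambda>x. - discrete_dt M \<tau> (deriv (\<eta> (k - 1))) (\<lambda>j. deriv (H (k - 1) j)) x))"
  using \<open>k \<le> n\<close>
proof (induction k)
  case 0
  have q0: "\<forall>\<^sub>F \<epsilon> in at_right 0. q \<epsilon> 0 = (\<lambda>x. (\<eta>0 x, v0 \<epsilon> x, deriv \<eta>0 x))"
    using bbmh by eventually_elim (simp add: bbmh_numerical_solution_def)
  have \<eta>0: "\<eta> 0 = \<eta>0" using bbm by (simp add: bbm_numerical_solution_def)
  have "C_tendsto (3 * stages M * n) L (\<lambda>\<epsilon>. \<eta>0) \<eta>0"
    "C_tendsto (3 * stages M * n) L (\<lambda>\<epsilon> x. \<epsilon>\<^sup>2 * v0 \<epsilon> x) (\<lambda>x. 0)"
    "C_tendsto (3 * stages M * n) L (\<lambda>\<epsilon>. deriv \<eta>0) (deriv \<eta>0)"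
    using init by (auto simp: N intro!: C_tendsto_const admissible_v0_tendsto periodic_C_deriv
        intro: periodic_C_mono)
  then show ?case
    using q0 init(1) unfolding \<eta>0
    by (auto elim!: C_tendsto_cong eventually_mono)
next
  case (Suc k)
  let ?s = "stages M" and ?l = "stages M - 1"
  define m where "m = 3 * ?s * (n - Suc k)"
  have m: "3 * ?s * (n - k) = m + 3 * ?s" "m + 3 * ?s + 4 \<le> N"
  proof -
    have "n - k = Suc (n - Suc k)" using Suc.prems by simp
    then show 1: "3 * ?s * (n - k) = m + 3 * ?s" by (simp add: m_def)
    have "3 * ?s * (n - k) \<le> 3 * ?s * n" by (intro mult_le_mono2) simp
    then show "m + 3 * ?s + 4 \<le> N" unfolding 1 N by simp
  qed
  have l: "?l < ?s" using M(1) by (simp add: dirk_imex_def)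
  have bbm': "bbm_step M \<tau> (\<eta> k) (H k) (\<eta> (Suc k))" "periodic_C 2 L (\<eta> k)" "periodic_C 2 L (\<eta> (Suc k))"
    "\<And>i. i < ?s \<Longrightarrow> periodic_C 2 L (H k i)"
    using bbm Suc.prems by (auto simp: bbm_numerical_solution_def)
  note IH = Suc.IH[OF Suc_leD[OF Suc.prems], unfolded m(1)]
  have H: "periodic_C N L (H k i)" if "i < ?s" for i
    using bbm_stage_regular[OF \<open>0 < \<tau>\<close> bbm'(1) conjunct1[OF IH] _ bbm'(4) that] by (simp add: N)
  have \<eta>': "\<eta> (Suc k) = H k ?l"
    by (rule bbm_step_GSA[OF M(1,3) \<open>0 < L\<close> \<open>0 < \<tau>\<close> bbm'])
  have step: "\<forall>\<^sub>F \<epsilon> in at_right 0. (\<forall>i<?s. bbmh_state L (Q \<epsilon> k i)) \<and>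
      imex_step M \<tau> (bbmh_f \<delta>1 \<delta>2 \<delta>3 \<epsilon>) (bbmh_g \<delta>1 \<delta>2 \<delta>3 \<epsilon>) (q \<epsilon> k) (Q \<epsilon> k) (q \<epsilon> (Suc k))"
    using bbmh by eventually_elim (use Suc.prems in \<open>auto simp: bbmh_numerical_solution_def\<close>)
  then have q': "\<forall>\<^sub>F \<epsilon> in at_right 0. q \<epsilon> (Suc k) = Q \<epsilon> k ?l"
    by eventually_elim (use imex_step_GSA[OF M(1,3)] in blast)
  have "C_tendsto (m + 3 * (?s - 1 - ?l)) L (\<lambda>\<epsilon>. u_of (Q \<epsilon> k ?l)) (H k ?l) \<and>
    C_tendsto (m + 3 * (?s - 1 - ?l)) L (\<lambda>\<epsilon>. v_of (Q \<epsilon> k ?l)) (bbm_v M \<tau> (\<eta> k) (H k) ?l) \<and>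
    C_tendsto (m + 3 * (?s - 1 - ?l)) L (\<lambda>\<epsilon>. w_of (Q \<epsilon> k ?l)) (deriv (H k ?l))"
    by (rule bbmh_stage_tendsto[OF M(1,2) par bbm'(1) _ _ step _ _ _ l])
      (use IH m(2) H in \<open>auto intro: periodic_C_mono\<close>)
  then have lim: "C_tendsto m L (\<lambda>\<epsilon>. u_of (Q \<epsilon> k ?l)) (\<eta> (Suc k))"
    "C_tendsto m L (\<lambda>\<epsilon>. v_of (Q \<epsilon> k ?l)) (bbm_v M \<tau> (\<eta> k) (H k) ?l)"
    "C_tendsto m L (\<lambda>\<epsilon>. w_of (Q \<epsilon> k ?l)) (deriv (\<eta> (Suc k)))"
    by (simp_all add: \<eta>')
  have cong: "C_tendsto m L (\<lambda>\<epsilon>. \<pi> \<epsilon> (q \<epsilon> (Suc k))) \<Phi>" if "C_tendsto m L (\<lambda>\<epsilon>. \<pi> \<epsilon> (Q \<epsilon> k ?l)) \<Phi>" for \<pi> \<Phi>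
    using that q' by (rule C_tendsto_cong[OF _ eventually_mono]) simp
  \<comment> \<open>Convergence of \<open>v\<close> in the last stage restores the invariant for the
    next step.\<close>
  have "C_tendsto m L (\<lambda>\<epsilon> x. \<epsilon>\<^sup>2 * v_of (Q \<epsilon> k ?l) x) (\<lambda>x. 0 * bbm_v M \<tau> (\<eta> k) (H k) ?l x)"
    by (intro C_tendsto_mult C_tendsto_scalar tendsto_at_right_0_intros lim par)
  then have "C_tendsto m L (\<lambda>\<epsilon> x. \<epsilon>\<^sup>2 * v_of (q \<epsilon> (Suc k)) x) (\<lambda>x. 0)"
    using cong[of "\<lambda>\<epsilon> p x. \<epsilon>\<^sup>2 * v_of p x"] by simp
  moreover have "C_tendsto m L (\<lambda>\<epsilon>. v_of (q \<epsilon> (Suc k)))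
      (\<lambda>x. - discrete_dt M \<tau> (deriv (\<eta> k)) (\<lambda>j. deriv (H k j)) x)"
    using cong[of "\<lambda>\<epsilon> p. v_of p", OF lim(2)] unfolding bbm_v_last[abs_def, symmetric] by simp
  ultimately show ?case
    using cong[of "\<lambda>\<epsilon> p. u_of p", OF lim(1)] cong[of "\<lambda>\<epsilon> p. w_of p", OF lim(3)] H[OF l]
    unfolding m_def[symmetric] by (simp add: \<eta>')
qed

theorem theorem4p6:
  fixes M :: imex and \<delta>1 \<delta>2 \<delta>3 \<Delta>t L :: real and n :: nat
  assumes "dirk_imex M" and "type_I M" and "GSA M"
    and "\<delta>1 \<in> {0..1}" and "\<delta>2 \<in> {0..1}" and "\<delta>3 \<in> {0..1}"
    and "0 < \<Delta>t" and "0 < L" and "1 \<le> n"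
  shows "\<exists>N. \<forall>(\<eta>0 :: real \<Rightarrow> real) (v0 :: real \<Rightarrow> real \<Rightarrow> real)
      (q :: real \<Rightarrow> nat \<Rightarrow> real \<Rightarrow> real \<times> real \<times> real)
      (Q :: real \<Rightarrow> nat \<Rightarrow> nat \<Rightarrow> real \<Rightarrow> real \<times> real \<times> real)
      (\<eta> :: nat \<Rightarrow> real \<Rightarrow> real) (H :: nat \<Rightarrow> nat \<Rightarrow> real \<Rightarrow> real).
      periodic_C N L \<eta>0 \<longrightarrow>
      admissible_v0 N L v0 \<longrightarrow>
      (\<forall>\<^sub>F \<epsilon> in at_right 0.
         bbmh_numerical_solution M \<delta>1 \<delta>2 \<delta>3 \<epsilon> L \<Delta>t n
           (\<lambda>x. (\<eta>0 x, v0 \<epsilon> x, deriv \<eta>0 x)) (q \<epsilon>) (Q \<epsilon>)) \<longrightarrow>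
      bbm_numerical_solution M L \<Delta>t n \<eta>0 \<eta> H \<longrightarrow>
      uniform_limit UNIV (\<lambda>\<epsilon>. u_of (q \<epsilon> n)) (\<eta> n) (at_right 0) \<and>
      uniform_limit UNIV (\<lambda>\<epsilon>. v_of (q \<epsilon> n))
        (\<lambda>x. - discrete_dt M \<Delta>t (deriv (\<eta> (n - 1))) (\<lambda>j. deriv (H (n - 1) j)) x) (at_right 0) \<and>
      uniform_limit UNIV (\<lambda>\<epsilon>. w_of (q \<epsilon> n)) (deriv (\<eta> n)) (at_right 0)"
proof (intro exI[of _ "3 * stages M * n + 4"] allI impI, goal_cases)
  case (1 \<eta>0 v0 q Q \<eta> H)
  \<comment> \<open>At \<open>k = n\<close> the remaining order
    \<open>3 * stages M * (n - k)\<close> is 0, which leaves exactly uniform convergence.\<close>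
  note lim = bbmh_steps_tendsto[OF assms(1-8) refl 1 order_refl]
  from lim \<open>1 \<le> n\<close> show ?case
    by (blast intro: C_tendsto_uniform_limit)
qed

end
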